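(* Let $m\geq 1$. A $2^m\times 2^m$ complex matrix $U$ can be exactly represented by an $m$-qubit circuit over $\mathcal{G}_{16}$ (possibly using ancillas) if and only if $U$ is unitary with all entries in $\mathcal{R}_{16}$. Furthermore, a single ancilla suffices to synthesize a circuit for such a $U$.
   Context: For $n$ divisible by 8, let $\zeta_n=e^{2\pi i/n}$ and let $\mathcal{G}_n$ be the gate set consisting of $H=\frac{1}{\sqrt2}\begin{bmatrix}1&1\\1&-1\end{bmatrix}$, $S=\mathrm{diag}(1,i)$, the two-qubit controlled-not $CX$, and $T_n=\mathrm{diag}(1,\zeta_n)$. $\mathcal{R}_n$ denotes the smallest subring of $\mathbb{C}$ containing $1/2$ and $\zeta_n$. An $m$-qubit unitary $U$ is exactly represented by a circuit over $\mathcal{G}_n$ using $a$ ancillas if there is a circuit $C$ over $\mathcal{G}_n$ on $m+a$ qubits such that $C(\mathbf{u}\otimes \mathbf{e}_0)=(U\mathbf{u})\otimes\mathbf{e}_0$ for every $\mathbf{u}\in\mathbb{C}^{2^m}$, where $\mathbf{e}_0$ is the all-zero computational basis state of the $a$ ancilla qubits. *)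

theory Defs
  imports Complex_Main "Jordan_Normal_Form.Matrix"
begin

definition zeta :: "nat \<Rightarrow> complex" where
  "zeta n = exp (2 * pi * \<i> / of_nat n)"

inductive_set ring_R :: "nat \<Rightarrow> complex set" for n :: nat where
  one:   "1 \<in> ring_R n"
| half:  "1/2 \<in> ring_R n"
| zeta:  "zeta n \<in> ring_R n"
| add:   "a \<in> ring_R n \<Longrightarrow> b \<in> ring_R n \<Longrightarrow> a + b \<in> ring_R n"
| neg:   "a \<in> ring_R n \<Longrightarrow> - a \<in> ring_R n"
| mult:  "a \<in> ring_R n \<Longrightarrow> b \<in> ring_R n \<Longrightarrow> a * b \<in> ring_R n"

definition adjoint :: "complex mat \<Rightarrow> complex mat" where
  "adjoint A = mat (dim_col A) (dim_row A) (\<lambda>(i, j). cnj (A $$ (j, i)))"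

definition unitary :: "complex mat \<Rightarrow> bool" where
  "unitary A \<longleftrightarrow> dim_row A = dim_col A \<and>
     A * adjoint A = 1\<^sub>m (dim_row A) \<and> adjoint A * A = 1\<^sub>m (dim_row A)"

definition H_gate :: "complex mat" where
  "H_gate = mat 2 2 (\<lambda>(i, j). (if i = 1 \<and> j = 1 then -1 else 1) / complex_of_real (sqrt 2))"

definition S_gate :: "complex mat" where
  "S_gate = mat 2 2 (\<lambda>(i, j). if i = j then (if i = 0 then 1 else \<i>) else 0)"

definition T_gate :: "nat \<Rightarrow> complex mat" where
  "T_gate n = mat 2 2 (\<lambda>(i, j). if i = j then (if i = 0 then 1 else zeta n) else 0)"

datatype gate = H nat | S nat | T nat | CX nat nat

text \<open>Qubits of an N-qubit register are numbered 0..N-1; qubit q corresponds to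
  bit N-1-q of a computational-basis index (qubit 0 is the most significant, so that
  the Kronecker product u \<otimes> v puts the qubits of u first).\<close>
definition qbit :: "nat \<Rightarrow> nat \<Rightarrow> nat \<Rightarrow> nat" where
  "qbit N q x = (x div 2 ^ (N - 1 - q)) mod 2"

definition flip_qbit :: "nat \<Rightarrow> nat \<Rightarrow> nat \<Rightarrow> nat" where
  "flip_qbit N q x = (if qbit N q x = 0 then x + 2 ^ (N - 1 - q) else x - 2 ^ (N - 1 - q))"

definition single_qubit_mat :: "nat \<Rightarrow> nat \<Rightarrow> complex mat \<Rightarrow> complex mat" where
  "single_qubit_mat N q G = mat (2 ^ N) (2 ^ N) (\<lambda>(r, c).
     if (\<forall>p < N. p \<noteq> q \<longrightarrow> qbit N p r = qbit N p c)
     then G $$ (qbit N q r, qbit N q c) else 0)"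

definition cx_mat :: "nat \<Rightarrow> nat \<Rightarrow> nat \<Rightarrow> complex mat" where
  "cx_mat N c t = mat (2 ^ N) (2 ^ N) (\<lambda>(r, s).
     if r = (if qbit N c s = 1 then flip_qbit N t s else s) then 1 else 0)"

fun gate_ok :: "nat \<Rightarrow> gate \<Rightarrow> bool" where
  "gate_ok N (H q) = (q < N)"
| "gate_ok N (S q) = (q < N)"
| "gate_ok N (T q) = (q < N)"
| "gate_ok N (CX c t) = (c < N \<and> t < N \<and> c \<noteq> t)"

fun gate_mat :: "nat \<Rightarrow> nat \<Rightarrow> gate \<Rightarrow> complex mat" where
  "gate_mat n N (H q) = single_qubit_mat N q H_gate"
| "gate_mat n N (S q) = single_qubit_mat N q S_gate"
| "gate_mat n N (T q) = single_qubit_mat N q (T_gate n)"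
| "gate_mat n N (CX c t) = cx_mat N c t"

definition circuit_mat :: "nat \<Rightarrow> nat \<Rightarrow> gate list \<Rightarrow> complex mat" where
  "circuit_mat n N C = foldl (\<lambda>M g. gate_mat n N g * M) (1\<^sub>m (2 ^ N)) C"

definition circuit_ok :: "nat \<Rightarrow> gate list \<Rightarrow> bool" where
  "circuit_ok N C \<longleftrightarrow> (\<forall>g \<in> set C. gate_ok N g)"

definition kron_vec :: "complex vec \<Rightarrow> complex vec \<Rightarrow> complex vec" where
  "kron_vec u v = vec (dim_vec u * dim_vec v)
     (\<lambda>i. u $ (i div dim_vec v) * v $ (i mod dim_vec v))"

definition exactly_represented :: "nat \<Rightarrow> nat \<Rightarrow> nat \<Rightarrow> complex mat \<Rightarrow> bool" where
  "exactly_represented n m a U \<longleftrightarrow>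
     (\<exists>C. circuit_ok (m + a) C \<and>
        (\<forall>u \<in> carrier_vec (2 ^ m).
           circuit_mat n (m + a) C *\<^sub>v kron_vec u (unit_vec (2 ^ a) 0)
             = kron_vec (U *\<^sub>v u) (unit_vec (2 ^ a) 0)))"

end

theory Submission
  imports Defs "Jordan_Normal_Form.Determinant"
begin

text \<open>
  Write \<open>\<omega>\<close> and \<open>\<zeta>\<close> for the primitive 8th and 16th roots of unity.  Gates preserve inner products
  and have entries in the ring, which gives one direction.

  Conversely, replace every entry \<open>p + \<zeta> q\<close> of \<open>U\<close> (with \<open>p\<close>, \<open>q\<close> over the 8th roots of unity) by the
  block \<open>p I + q Z\<close>, where \<open>Z\<^sup>2 = \<omega> I\<close>.  The result is a unitary on one more qubit which acts as
  \<open>U\<close> when that qubit is in the eigenstate of \<open>Z\<close> for \<open>\<zeta>\<close>, a state that the ancilla can be brought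
  into and out of.  Over the 8th roots of unity any two entries of a column that are odd at the prime
  \<open>1 + \<omega>\<close> can be combined by a phase and a Hadamard matrix into even ones, so the larger unitary is a
  product of two-level Hadamard matrices and one-level phases.  Two-level operators of determinant 1 are
  circuits without further ancillas, being commutators of multiply controlled gates.  What remains is a
  phase on one level, which can be traded for a power of \<open>\<zeta>\<close> on one level of \<open>U\<close> itself; that
  factor is removed using the ancilla once it has been reset.
\<close>

text \<open>The reduction cannot be run in the same way over the sixteenth roots of unity: modulo
  \<open>sqrt 2 (1 + \<zeta>)\<close> there are sixteen odd residue classes but only eight distinct
  powers of \<zeta>. Over the eighth roots the count works out, with four odd classes modulo
  \<open>sqrt 2 (1 + \<omega>)\<close> and four powers of \<omega>. For the block matrix to inherit
  unitarity, \<open>p\<close> and \<open>q\<close> must be determined by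
  \<open>p + \<zeta> q\<close>; this is the reason for the independence results over the integers.

  The bound of one ancilla is shaped by determinants. The eigenstate occupies that ancilla, so a
  gate controlled by all other qubits has no idle qubit to borrow, and commutators give only
  operators of determinant 1. A phase on one level is out of their reach. However, a suitable power
  of \<open>Z\<close> on a single block has the same determinant as that phase, and on the
  eigenstate it is a mere scalar. After the reset, the states with ancilla value 1 are
  unconstrained, which leaves room to cancel the scalar by a phase gate on the ancilla.\<close>

abbreviation omega8 :: complex ("\<omega>") where "\<omega> \<equiv> zeta 8"
abbreviation zeta16 :: complex ("\<zeta>") where "\<zeta> \<equiv> zeta 16"

section \<open>Arithmetic of the eighth and sixteenth roots of unity\<close>

lemma zeta_cis: "zeta n = cis (2 * pi / n)"
  by (simp add: zeta_def cis_conv_exp mult_ac)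

lemma omega_Complex: "\<omega> = Complex (1 / sqrt 2) (1 / sqrt 2)"
proof -
  have "2 * pi / real 8 = pi / 4" by simp
  then show ?thesis
    by (simp add: zeta_cis cis.ctr cos_45 sin_45 real_div_sqrt field_simps)
qed

lemma omega_squared: "\<omega>\<^sup>2 = \<i>"
  by (simp add: omega_Complex power2_eq_square complex_eq_iff field_simps)

lemma zeta_squared: "\<zeta>\<^sup>2 = \<omega>"
  by (simp add: zeta_cis power2_eq_square cis_mult)

lemma cnj_zeta_mult [simp]: "cnj \<zeta> * \<zeta> = 1" "\<zeta> * cnj \<zeta> = 1"
  by (simp_all add: zeta_cis cis_cnj cis_mult)

lemma omega_power4: "\<omega> ^ 4 = -1"
  using omega_squared by (simp add: power4_eq_xxxx power2_eq_square mult.assoc)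

lemma omega_power8: "\<omega> ^ 8 = 1"
proof -
  have "\<omega> ^ 8 = (\<omega> ^ 4)\<^sup>2" by (simp flip: power_mult)
  then show ?thesis by (simp add: omega_power4)
qed

lemma zeta_power8: "\<zeta> ^ 8 = -1"
proof -
  have "\<zeta> ^ 8 = (\<zeta>\<^sup>2) ^ 4" by (simp flip: power_mult)
  then show ?thesis by (simp add: zeta_squared omega_power4)
qed

lemma zeta_power16: "\<zeta> ^ 16 = 1"
proof -
  have "\<zeta> ^ 16 = (\<zeta> ^ 8)\<^sup>2" by (simp flip: power_mult)
  then show ?thesis by (simp add: zeta_power8)
qed

lemma cnj_omega: "cnj \<omega> = \<omega> ^ 7"
proof -
  have "cnj \<omega> * \<omega> = 1" by (simp add: zeta_cis cis_cnj cis_mult)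
  moreover have "\<omega> ^ 7 * \<omega> = 1" using omega_power8 by (simp add: eval_nat_numeral mult_ac)
  moreover have "\<omega> \<noteq> 0" by (simp add: zeta_cis)
  ultimately show ?thesis by (metis mult_right_cancel)
qed

lemma cnj_zeta: "cnj \<zeta> = \<zeta> ^ 15"
proof -
  have "\<zeta> ^ 15 * \<zeta> = 1" using zeta_power16 by (simp add: eval_nat_numeral mult_ac)
  moreover have "\<zeta> \<noteq> 0" by (simp add: zeta_cis)
  ultimately show ?thesis using cnj_zeta_mult(1) by (metis mult_right_cancel)
qed

lemma cnj_omega_mult [simp]: "cnj \<omega> * \<omega> = 1" "\<omega> * cnj \<omega> = 1"
  by (simp_all add: zeta_cis cis_cnj cis_mult)

abbreviation rt2 :: complex where "rt2 \<equiv> complex_of_real (sqrt 2)"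

lemma rt2_squared: "rt2 * rt2 = 2"
  by (simp flip: of_real_mult)

text \<open>Since \<open>\<omega> ^ 4 = -1\<close>, the term \<open>- \<omega> ^ 3\<close> is the
  conjugate of \<omega>, and the sum is \<open>2 cos (pi / 4)\<close>. This places the Hadamard
  entries in the ring.\<close>

lemma rt2_omega: "rt2 = \<omega> - \<omega> ^ 3"
  by (simp add: omega_Complex power3_eq_cube complex_eq_iff field_simps)

lemma inverse_rt2: "1 / rt2 = 1 / 2 * (\<omega> - \<omega> ^ 3)"
proof -
  have "1 / rt2 = 1 / 2 * rt2" using rt2_squared by (simp add: field_simps)
  then show ?thesis by (simp only: rt2_omega)
qed

subsection \<open>The rings generated by 1/2 and a root of unity\<close>

lemma ring_R_0 [simp]: "0 \<in> ring_R n"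
  using ring_R.add[OF ring_R.one ring_R.neg[OF ring_R.one]] by simp

lemma ring_R_diff: "a \<in> ring_R n \<Longrightarrow> b \<in> ring_R n \<Longrightarrow> a - b \<in> ring_R n"
  using ring_R.add[OF _ ring_R.neg, of a n b] by simp

lemma ring_R_power: "a \<in> ring_R n \<Longrightarrow> a ^ k \<in> ring_R n"
  by (induction k) (auto intro: ring_R.intros)

lemma ring_R_sum: "(\<And>x. x \<in> A \<Longrightarrow> f x \<in> ring_R n) \<Longrightarrow> sum f A \<in> ring_R n"
  by (induction A rule: infinite_finite_induct) (auto intro: ring_R.intros)

lemma ring_R_8_16: "a \<in> ring_R 8 \<Longrightarrow> a \<in> ring_R 16"
proof (induction rule: ring_R.induct)
  case zeta
  then show ?case by (metis zeta_squared ring_R_power ring_R.zeta)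
qed (auto intro: ring_R.intros)

lemma ring_R_8_consts: "1 / rt2 \<in> ring_R 8" "\<i> \<in> ring_R 8"
  unfolding inverse_rt2 omega_squared[symmetric]
  by (intro ring_R.mult ring_R.half ring_R_diff ring_R.zeta ring_R_power)+

lemma cnj_ring_R_8: "a \<in> ring_R 8 \<Longrightarrow> cnj a \<in> ring_R 8"
  by (induction rule: ring_R.induct)
     (auto intro: ring_R.intros ring_R_power simp: cnj_omega simp del: cnj_omega_mult)

lemma cnj_ring_R_16: "a \<in> ring_R 16 \<Longrightarrow> cnj a \<in> ring_R 16"
  by (induction rule: ring_R.induct)
     (auto intro: ring_R.intros ring_R_power simp: cnj_zeta)

text \<open>\<zeta> is a root of \<open>X ^ 2 - \<omega>\<close>, so products of such expressions
  fold back to the same form.\<close>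

lemma ring_R_16_split: "a \<in> ring_R 16 \<Longrightarrow> \<exists>p\<in>ring_R 8. \<exists>q\<in>ring_R 8. a = p + \<zeta> * q"
proof (induction rule: ring_R.induct)
  case one then show ?case by (intro bexI[of _ 1] bexI[of _ 0]) (auto intro: ring_R.intros)
next
  case half then show ?case by (intro bexI[of _ "1/2"] bexI[of _ 0]) (auto intro: ring_R.intros)
next
  case zeta then show ?case by (intro bexI[of _ 0] bexI[of _ 1]) (auto intro: ring_R.intros)
next
  case (add a b)
  then obtain p q p' q' where *: "p \<in> ring_R 8" "q \<in> ring_R 8" "p' \<in> ring_R 8" "q' \<in> ring_R 8"
    "a = p + \<zeta> * q" "b = p' + \<zeta> * q'" by blast
  show ?case by (intro bexI[of _ "p + p'"] bexI[of _ "q + q'"])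
    (use * in \<open>auto intro: ring_R.intros simp: algebra_simps\<close>)
next
  case (neg a)
  then obtain p q where *: "p \<in> ring_R 8" "q \<in> ring_R 8" "a = p + \<zeta> * q" by blast
  show ?case by (intro bexI[of _ "-p"] bexI[of _ "-q"]) (use * in \<open>auto intro: ring_R.intros\<close>)
next
  case (mult a b)
  then obtain p q p' q' where *: "p \<in> ring_R 8" "q \<in> ring_R 8" "p' \<in> ring_R 8" "q' \<in> ring_R 8"
    "a = p + \<zeta> * q" "b = p' + \<zeta> * q'" by blast
  have "a * b = (p * p' + \<omega> * (q * q')) + \<zeta> * (p * q' + q * p')"
    unfolding * zeta_squared[symmetric] by (simp add: algebra_simps power2_eq_square)
  then show ?case by (intro bexI[of _ "p * p' + \<omega> * (q * q')"] bexI[of _ "p * q' + q * p'"])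
    (use * in \<open>auto intro: ring_R.intros\<close>)
qed

subsection \<open>Integer coordinates\<close>

type_synonym quad = "int \<times> int \<times> int \<times> int"

fun val :: "quad \<Rightarrow> complex" where
  "val (a, b, c, d) = of_int a + of_int b * \<omega> + of_int c * \<omega>\<^sup>2 + of_int d * \<omega> ^ 3"

text \<open>Because \<omega> is congruent to 1 modulo the prime \<open>1 + \<omega>\<close>, whose
  residue field has two elements, the parity of the coordinate sum is the residue of
  \<open>val\<close> modulo that prime.\<close>

fun quad_odd :: "quad \<Rightarrow> bool" where
  "quad_odd (a, b, c, d) = odd (a + b + c + d)"

fun quad_sq :: "quad \<Rightarrow> int" where
  "quad_sq (a, b, c, d) = a\<^sup>2 + b\<^sup>2 + c\<^sup>2 + d\<^sup>2"

text \<open>The coefficient of \<open>sqrt 2\<close> in the squared absolute value of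
  \<open>val\<close>, whose rational part is \<open>quad_sq\<close>. The minus sign reflects
  \<open>\<omega> ^ 4 = -1\<close>.\<close>

fun quad_cross :: "quad \<Rightarrow> int" where
  "quad_cross (a, b, c, d) = a * b + b * c + c * d - d * a"

lemma val_add: "val (a, b, c, d) + val (a', b', c', d') = val (a + a', b + b', c + c', d + d')"
  by (simp add: algebra_simps)

lemma val_uminus: "- val (a, b, c, d) = val (- a, - b, - c, - d)"
  by simp

lemma val_mult: "val (a, b, c, d) * val (a', b', c', d') =
  val (a * a' - b * d' - c * c' - d * b', a * b' + b * a' - c * d' - d * c',
       a * c' + b * b' + c * a' - d * d', a * d' + b * c' + c * b' + d * a')"
proof -
  \<comment> \<open>A polynomial identity in a free \<open>w\<close>: the multiple of
    \<open>w ^ 4 + 1\<close> that disappears at \<omega> is written out, so no reduction rule for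
    \<omega> is needed while expanding.\<close>
  have "(A + B * w + C * w\<^sup>2 + D * w ^ 3) * (A' + B' * w + C' * w\<^sup>2 + D' * w ^ 3) =
    (A * A' - B * D' - C * C' - D * B') + (A * B' + B * A' - C * D' - D * C') * w +
    (A * C' + B * B' + C * A' - D * D') * w\<^sup>2 + (A * D' + B * C' + C * B' + D * A') * w ^ 3 +
    (w ^ 4 + 1) * (B * D' + C * C' + D * B' + (C * D' + D * C') * w + D * D' * w\<^sup>2)"
    for A B C D A' B' C' D' w :: complex
    by (simp add: algebra_simps power2_eq_square power3_eq_cube power4_eq_xxxx)
  from this[of _ _ \<omega>] show ?thesis by (simp add: omega_power4)
qed

lemma range_val_add: "x \<in> range val \<Longrightarrow> y \<in> range val \<Longrightarrow> x + y \<in> range val"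
  by (auto simp: val_add simp del: val.simps)

lemma range_val_mult: "x \<in> range val \<Longrightarrow> y \<in> range val \<Longrightarrow> x * y \<in> range val"
  by (auto simp: val_mult simp del: val.simps)

lemma range_val_uminus: "x \<in> range val \<Longrightarrow> - x \<in> range val"
  by (auto simp: val_uminus simp del: val.simps)

lemma range_val_of_int: "of_int n \<in> range val"
  by (rule range_eqI[of _ _ "(n, 0, 0, 0)"]) simp

lemma range_val_omega: "\<omega> \<in> range val"
  by (rule range_eqI[of _ _ "(0, 1, 0, 0)"]) simp

lemma range_val_power: "x \<in> range val \<Longrightarrow> x ^ n \<in> range val"
proof (induction n)
  case 0 then show ?case using range_val_of_int[of 1] by (simp del: val.simps)
qed (auto intro: range_val_mult)

lemma val_Complex: "val (a, b, c, d) =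
  Complex (of_int a + of_int (b - d) / sqrt 2) (of_int c + of_int (b + d) / sqrt 2)"
  by (simp add: omega_Complex complex_eq_iff power2_eq_square power3_eq_cube field_simps)

lemma ring_R_8_val: "x \<in> ring_R 8 \<Longrightarrow> \<exists>k. \<exists>y\<in>range val. x = y / 2 ^ k"
proof (induction rule: ring_R.induct)
  case one
  then show ?case using range_val_of_int[of 1] by (intro exI[of _ 0]) (auto simp del: val.simps)
next
  case half
  then show ?case using range_val_of_int[of 1] by (intro exI[of _ 1]) (auto simp del: val.simps)
next
  case zeta
  then show ?case using range_val_omega by (intro exI[of _ 0]) (auto simp del: val.simps)
next
  case (add a b)
  then obtain k l x y where *: "x \<in> range val" "y \<in> range val" "a = x / 2 ^ k" "b = y / 2 ^ l" by blast
  have "a + b = (x * of_int (2 ^ l) + y * of_int (2 ^ k)) / 2 ^ (k + l)"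
    using * by (simp add: add_divide_distrib power_add)
  then show ?case
    using * by (blast intro: range_val_add range_val_mult range_val_of_int)
next
  case (neg a)
  then obtain k x where "x \<in> range val" "a = x / 2 ^ k" by blast
  then show ?case by (intro exI[of _ k] bexI[of _ "- x"]) (auto intro: range_val_uminus simp del: val.simps)
next
  case (mult a b)
  then obtain k l x y where *: "x \<in> range val" "y \<in> range val" "a = x / 2 ^ k" "b = y / 2 ^ l" by blast
  then have "a * b = (x * y) / 2 ^ (k + l)" by (simp add: power_add)
  then show ?case using * by (blast intro: range_val_mult)
qed

section \<open>Linear independence over the integers\<close>

text \<open>Infinite descent: in \<open>a ^ 2 = 2 b ^ 2\<close> with \<open>b\<close> nonzero,
  \<open>a\<close> is even, and the pair \<open>(b, a / 2)\<close> solves the same equation with a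
  smaller second component.\<close>

lemma sqrt2_independent_int:
  fixes a b :: int
  assumes "of_int a + of_int b * sqrt 2 = 0"
  shows "a = 0" "b = 0"
proof -
  have *: "\<exists>c d::int. \<bar>d\<bar> < \<bar>b\<bar> \<and> d \<noteq> 0 \<and> c\<^sup>2 = 2 * d\<^sup>2" if "a\<^sup>2 = 2 * b\<^sup>2" "b \<noteq> 0" for a b :: int
  proof -
    have "even (a\<^sup>2)" using that by simp
    then obtain c where c: "a = 2 * c" by (auto elim: evenE)
    then have b: "b\<^sup>2 = 2 * c\<^sup>2" using that by (simp add: power2_eq_square)
    have "c \<noteq> 0" using b that by auto
    then have "c\<^sup>2 < b\<^sup>2" using b by simp
    then have "\<bar>c\<bar> < \<bar>b\<bar>" by (simp add: abs_less_iff power2_less_imp_less abs_square_less_1 flip: abs_le_square_iff not_le)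
    then show ?thesis using b \<open>c \<noteq> 0\<close> by blast
  qed
  have no: "a\<^sup>2 = 2 * b\<^sup>2 \<Longrightarrow> b = 0" for a b :: int
  proof (induction "nat \<bar>b\<bar>" arbitrary: a b rule: less_induct)
    case less
    show ?case
    proof (rule ccontr)
      assume "b \<noteq> 0"
      from *[OF less.prems this] obtain c d :: int where "\<bar>d\<bar> < \<bar>b\<bar>" "d \<noteq> 0" "c\<^sup>2 = 2 * d\<^sup>2" by blast
      then show False using less.hyps[of d c] by simp
    qed
  qed
  have "of_int a = - (of_int b * sqrt 2)" using assms by linarith
  then have "(of_int a)\<^sup>2 = (of_int b)\<^sup>2 * (2::real)" by (simp add: power_mult_distrib)
  then have "of_int (a\<^sup>2) = (of_int (2 * b\<^sup>2) :: real)" by simp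
  then have "a\<^sup>2 = 2 * b\<^sup>2" by linarith
  then show "b = 0" by (rule no)
  then show "a = 0" using assms by simp
qed

text \<open>Used for \<open>t = 2 cos (\<pi> / 8)\<close>.  Taking norms from \<open>\<rat>(\<surd>2)\<close> to \<open>\<rat>\<close> in \<open>(a + b \<surd>2)\<^sup>2 = (2 + \<surd>2) (c + d \<surd>2)\<^sup>2\<close> would make
  \<open>\<surd>2\<close> rational.\<close>
lemma real_subfield_independent:
  fixes a b c d :: int and t :: real
  assumes "t\<^sup>2 = 2 + sqrt 2" and "of_int a + of_int b * sqrt 2 + t * (of_int c + of_int d * sqrt 2) = 0"
  shows "a = 0 \<and> b = 0 \<and> c = 0 \<and> d = 0"
proof -
  let ?a = "of_int a :: real" and ?b = "of_int b :: real" and ?c = "of_int c :: real" and ?d = "of_int d :: real"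
  have "(?a + ?b * sqrt 2)\<^sup>2 = t\<^sup>2 * (?c + ?d * sqrt 2)\<^sup>2"
    using assms(2) by (metis add_eq_0_iff power2_minus power_mult_distrib)
  then have "of_int (a\<^sup>2 + 2 * b\<^sup>2 - (2 * c\<^sup>2 + 4 * d\<^sup>2 + 4 * c * d)) +
      of_int (2 * a * b - (c\<^sup>2 + 2 * d\<^sup>2 + 4 * c * d)) * sqrt 2 = 0"
    unfolding assms(1) by (simp add: power2_eq_square algebra_simps)
  from sqrt2_independent_int[OF this]
  have 1: "a\<^sup>2 + 2 * b\<^sup>2 = 2 * c\<^sup>2 + 4 * d\<^sup>2 + 4 * c * d" and 2: "2 * a * b = c\<^sup>2 + 2 * d\<^sup>2 + 4 * c * d"
    by linarith+
  \<comment> \<open>The left side is the norm of \<open>(a + b sqrt 2) ^ 2\<close>. On the other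
    side of the equation \<open>2 + sqrt 2\<close> has norm 2, so a square becomes twice a
    square.\<close>
  have "(a\<^sup>2 - 2 * b\<^sup>2)\<^sup>2 = (a\<^sup>2 + 2 * b\<^sup>2)\<^sup>2 - 2 * (2 * a * b)\<^sup>2"
    by (simp add: power2_eq_square algebra_simps)
  then have "(a\<^sup>2 - 2 * b\<^sup>2)\<^sup>2 = 2 * (c\<^sup>2 - 2 * d\<^sup>2)\<^sup>2" unfolding 1 2 by (simp add: power2_eq_square algebra_simps)
  moreover have sq: "X + Y * sqrt 2 = 0 \<or> X + (- Y) * sqrt 2 = 0" if "X\<^sup>2 = (Y * sqrt 2)\<^sup>2" for X Y
    using that by (auto simp: power2_eq_iff)
  ultimately have "(of_int (a\<^sup>2 - 2 * b\<^sup>2) :: real)\<^sup>2 = (of_int (c\<^sup>2 - 2 * d\<^sup>2) * sqrt 2)\<^sup>2"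
    unfolding power_mult_distrib of_int_power[symmetric] by simp
  then have "of_int (a\<^sup>2 - 2 * b\<^sup>2) + of_int (c\<^sup>2 - 2 * d\<^sup>2) * sqrt 2 = 0 \<or>
      of_int (a\<^sup>2 - 2 * b\<^sup>2) + of_int (- (c\<^sup>2 - 2 * d\<^sup>2)) * sqrt 2 = 0"
    unfolding of_int_minus by (rule sq)
  then have "a\<^sup>2 - 2 * b\<^sup>2 = 0 \<and> c\<^sup>2 - 2 * d\<^sup>2 = 0"
    using sqrt2_independent_int[of "a\<^sup>2 - 2 * b\<^sup>2" "c\<^sup>2 - 2 * d\<^sup>2"]
      sqrt2_independent_int[of "a\<^sup>2 - 2 * b\<^sup>2" "- (c\<^sup>2 - 2 * d\<^sup>2)"] by (metis neg_equal_0_iff_equal)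
  then have "(of_int a)\<^sup>2 = (of_int b * sqrt 2)\<^sup>2 \<and> (of_int c)\<^sup>2 = (of_int d * sqrt 2)\<^sup>2"
    by (simp add: power_mult_distrib) (metis (no_types, lifting) mult.commute of_int_mult of_int_numeral of_int_power)
  then have "(of_int a + of_int b * sqrt 2 = 0 \<or> of_int a + of_int (- b) * sqrt 2 = 0) \<and>
      (of_int c + of_int d * sqrt 2 = 0 \<or> of_int c + of_int (- d) * sqrt 2 = 0)"
    unfolding of_int_minus by (elim conjE) (intro conjI sq; assumption)
  then show ?thesis 
    using sqrt2_independent_int[of a b] sqrt2_independent_int[of a "- b"]
      sqrt2_independent_int[of c d] sqrt2_independent_int[of c "- d"] by (metis neg_equal_0_iff_equal)
qed

text \<open>Uses \<open>tan (pi / 8) = sqrt 2 - 1\<close>: both parts of \<zeta> are then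
  \<open>t\<close> times an element of the field generated by \<open>sqrt 2\<close>.\<close>

lemma zeta_Complex:
  obtains t where "t\<^sup>2 = 2 + sqrt 2" "\<zeta> = Complex (t / 2) (t * (sqrt 2 - 1) / 2)"
proof -
  define t where "t = 2 * cos (pi / 8)"
  have z: "\<zeta> = Complex (cos (pi / 8)) (sin (pi / 8))"
    by (simp add: zeta_cis cis.ctr)
  have "cos (2 * (pi / 8)) = sqrt 2 / 2" "sin (2 * (pi / 8)) = sqrt 2 / 2"
    using cos_45 sin_45 by simp_all
  then have c: "2 * (cos (pi / 8))\<^sup>2 - 1 = sqrt 2 / 2" and s: "2 * sin (pi / 8) * cos (pi / 8) = sqrt 2 / 2"
    unfolding cos_double_cos sin_double by simp_all
  have t2: "t\<^sup>2 = 2 + sqrt 2" using c by (simp add: t_def power_mult_distrib)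
  then have "t \<noteq> 0" by (metis add_pos_pos less_numeral_extra(3) real_sqrt_gt_0_iff zero_eq_power2 zero_less_numeral)
  have "t * sin (pi / 8) = sqrt 2 / 2" using s by (simp add: t_def mult_ac)
  also have "\<dots> = t * (t * (sqrt 2 - 1) / 2)"
    using t2 by (simp add: power2_eq_square algebra_simps) (simp flip: mult.assoc add: algebra_simps)
  finally have "sin (pi / 8) = t * (sqrt 2 - 1) / 2" using \<open>t \<noteq> 0\<close> by simp
  then show ?thesis using that[OF t2] z by (simp add: t_def)
qed

text \<open>The real and the imaginary part of the relation are each a relation between 1 and
  \<open>t\<close> with coefficients in the integers extended by \<open>sqrt 2\<close>, and
  \<open>t\<close> is quadratic over that field.\<close>

lemma val_zeta_independent:
  assumes "val p + \<zeta> * val q = 0"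
  shows "val p = 0" "val q = 0"
proof -
  obtain a b c d where p: "p = (a, b, c, d)" by (metis prod.exhaust)
  obtain a' b' c' d' where q: "q = (a', b', c', d')" by (metis prod.exhaust)
  obtain t where t: "t\<^sup>2 = 2 + sqrt 2" "\<zeta> = Complex (t / 2) (t * (sqrt 2 - 1) / 2)" by (rule zeta_Complex)
  have r: "x / sqrt 2 = x * sqrt 2 / 2" for x by (simp add: field_simps)
  have "Re (val p + \<zeta> * val q) = 0" "Im (val p + \<zeta> * val q) = 0" using assms by simp_all
  \<comment> \<open>Four times the real and the imaginary part, which clears all
    denominators.\<close>
  then have "of_int (4 * a) + of_int (2 * (b - d)) * sqrt 2 +
      t * (of_int (2 * (a' - b' - d' + c')) + of_int (2 * (b' - c')) * sqrt 2) = 0"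
    and "of_int (4 * c) + of_int (2 * (b + d)) * sqrt 2 +
      t * (of_int (2 * (c' + b' - d' - a')) + of_int (2 * (a' + d')) * sqrt 2) = 0"
    unfolding p q t(2) val_Complex r by (simp_all add: field_simps)
  from this[THEN real_subfield_independent[OF t(1)]]
  have "a = 0 \<and> b = 0 \<and> c = 0 \<and> d = 0" "a' = 0 \<and> b' = 0 \<and> c' = 0 \<and> d' = 0"
    by presburger+
  then show "val p = 0" "val q = 0" by (simp_all add: p q)
qed

text \<open>This makes the decomposition \<open>p + \<zeta> q\<close> unique, so that an equation
  over the sixteenth roots of unity splits into two over the eighth roots.\<close>

lemma ring_R_8_zeta_independent:
  assumes "p \<in> ring_R 8" "q \<in> ring_R 8" "p + \<zeta> * q = 0"
  shows "p = 0" "q = 0"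
proof -
  obtain k x where x: "x \<in> range val" "p = x / 2 ^ k" using ring_R_8_val[OF assms(1)] by blast
  obtain l y where y: "y \<in> range val" "q = y / 2 ^ l" using ring_R_8_val[OF assms(2)] by blast
  have "x * of_int (2 ^ l) \<in> range val" "y * of_int (2 ^ k) \<in> range val"
    by (intro range_val_mult range_val_of_int x(1) y(1))+
  then obtain u v where u: "x * of_int (2 ^ l) = val u" and v: "y * of_int (2 ^ k) = val v" by blast
  have "val u + \<zeta> * val v = (p + \<zeta> * q) * 2 ^ (k + l)"
    unfolding u[symmetric] v[symmetric] x y by (simp add: field_simps power_add)
  then have "val u = 0" "val v = 0" using val_zeta_independent[of u v] assms(3) by simp_all
  then show "p = 0" "q = 0" using u v x y by simp_all
qed

subsection \<open>Circuits acting on amplitude functions\<close>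

type_synonym m2 = "complex \<times> complex \<times> complex \<times> complex"
type_synonym amp = "nat \<Rightarrow> complex"

fun m2_mult :: "m2 \<Rightarrow> m2 \<Rightarrow> m2" (infixl "\<odot>" 70) where
  "(a, b, c, d) \<odot> (a', b', c', d') =
     (a * a' + b * c', a * b' + b * d', c * a' + d * c', c * b' + d * d')"

abbreviation m2_id :: m2 ("\<one>\<^sub>2") where "\<one>\<^sub>2 \<equiv> (1, 0, 0, 1)"
abbreviation m2_X :: m2 where "m2_X \<equiv> (0, 1, 1, 0)"
abbreviation m2_H :: m2 where "m2_H \<equiv> (1 / rt2, 1 / rt2, 1 / rt2, - 1 / rt2)"
abbreviation m2_diag :: "complex \<Rightarrow> complex \<Rightarrow> m2" where "m2_diag a d \<equiv> (a, 0, 0, d)"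

text \<open>Amplitudes are indexed by all natural numbers, so that operators acting on bit \<open>p\<close> compose without
  side conditions.  A register of \<open>N\<close> qubits uses the indices below \<open>2 ^ N\<close>, and its qubit \<open>q\<close> is bit
  \<open>N - 1 - q\<close>.\<close>
definition loc :: "nat \<Rightarrow> (nat \<Rightarrow> m2) \<Rightarrow> amp \<Rightarrow> amp" where
  "loc p M f z = (case M z of (a, b, c, d) \<Rightarrow>
     if bit z p then c * f (flip_bit p z) + d * f z else a * f z + b * f (flip_bit p z))"

lemma bit_flip_bit_nat: "bit (flip_bit p z) q \<longleftrightarrow> (if q = p then \<not> bit z q else bit z q)" for z :: nat
  by (auto simp: bit_simps)

lemma flip_flip_bit [simp]: "flip_bit p (flip_bit p z) = z" for z :: nat
  by (rule bit_eqI) (simp add: bit_flip_bit_nat)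

lemma flip_bit_commute: "flip_bit p (flip_bit q z) = flip_bit q (flip_bit p z)" for z :: nat
  by (rule bit_eqI) (simp add: bit_flip_bit_nat)

lemma less_power2_iff_bit: "z < 2 ^ N \<longleftrightarrow> (\<forall>q\<ge>N. \<not> bit z q)" for z :: nat
proof -
  have "z < 2 ^ N \<longleftrightarrow> take_bit N z = z" by (simp add: take_bit_nat_eq_self_iff)
  also have "\<dots> \<longleftrightarrow> (\<forall>q\<ge>N. \<not> bit z q)" 
  proof
    assume "take_bit N z = z"
    then show "\<forall>q\<ge>N. \<not> bit z q" by (metis bit_take_bit_iff not_less)
  next
    assume "\<forall>q\<ge>N. \<not> bit z q"
    then show "take_bit N z = z" by (intro bit_eqI) (metis bit_take_bit_iff not_less)
  qed
  finally show ?thesis .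
qed

lemma flip_bit_less_iff [simp]: "p < N \<Longrightarrow> flip_bit p z < 2 ^ N \<longleftrightarrow> z < 2 ^ N" for z :: nat
  by (auto simp: less_power2_iff_bit bit_flip_bit_nat)

lemma flip_bit_ge_iff [simp]: "p < N \<Longrightarrow> 2 ^ N \<le> flip_bit p z \<longleftrightarrow> 2 ^ N \<le> z" for z :: nat
  using flip_bit_less_iff[of p N z] by linarith

lemma flip_bit_neq [simp]: "flip_bit p z \<noteq> z" "z \<noteq> flip_bit p z" for z :: nat
  using bit_flip_bit_nat[of p z p] by auto

text \<open>The two amplitudes that bit \<open>p\<close> pairs must be transformed by the same inner
  matrix; hence the invariance of \<open>M'\<close> under flipping that bit.\<close>

lemma loc_comp:
  assumes "\<And>z. M' (flip_bit p z) = M' z"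
  shows "loc p M (loc p M' f) = loc p (\<lambda>z. M z \<odot> M' z) f"
proof
  fix z
  obtain a b c d a' b' c' d' where "M z = (a, b, c, d)" "M' z = (a', b', c', d')"
    by (metis prod.exhaust)
  then show "loc p M (loc p M' f) z = loc p (\<lambda>z. M z \<odot> M' z) f z"
    using assms[of z] by (simp add: loc_def bit_flip_bit_nat algebra_simps)
qed

lemma loc_id: "loc p (\<lambda>_. \<one>\<^sub>2) f = f"
  by (simp add: loc_def fun_eq_iff)

fun gapp :: "nat \<Rightarrow> gate \<Rightarrow> amp \<Rightarrow> amp" where
  "gapp N (H q) = loc (N - 1 - q) (\<lambda>_. m2_H)"
| "gapp N (S q) = loc (N - 1 - q) (\<lambda>_. m2_diag 1 \<i>)"
| "gapp N (T q) = loc (N - 1 - q) (\<lambda>_. m2_diag 1 \<zeta>)"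
| "gapp N (CX c t) = loc (N - 1 - t) (\<lambda>z. if bit z (N - 1 - c) then m2_X else \<one>\<^sub>2)"

definition capp :: "nat \<Rightarrow> gate list \<Rightarrow> amp \<Rightarrow> amp" where
  "capp N C = fold (gapp N) C"

definition supp :: "nat \<Rightarrow> amp \<Rightarrow> bool" where
  "supp N f \<longleftrightarrow> (\<forall>z\<ge>2 ^ N. f z = 0)"

lemma supp_loc: "p < N \<Longrightarrow> supp N f \<Longrightarrow> supp N (loc p M f)"
  by (simp add: supp_def loc_def split: prod.split)

lemma supp_gapp: "gate_ok N g \<Longrightarrow> supp N f \<Longrightarrow> supp N (gapp N g f)"
  by (cases g) (simp_all add: supp_loc)

lemma supp_capp: "circuit_ok N C \<Longrightarrow> supp N f \<Longrightarrow> supp N (capp N C f)"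
  by (induction C arbitrary: f) (simp_all add: capp_def circuit_ok_def supp_gapp)

lemma qbit_bit: "qbit N q z = of_bool (bit z (N - 1 - q))"
  by (simp add: qbit_def bit_iff_odd mod_2_eq_odd)

lemma flip_qbit_flip_bit: "flip_qbit N q z = flip_bit (N - 1 - q) z"
proof -
  have *: "flip_bit p u = u + 2 ^ p" if "\<not> bit u p" for p and u :: nat
    using that by (simp add: flip_bit_eq_if set_bit_eq)
  have "flip_bit p z = z - 2 ^ p" if "bit z p" for p
    using *[of "flip_bit p z" p] that by (simp add: bit_flip_bit_nat)
  with * have "flip_bit p z = (if bit z p then z - 2 ^ p else z + 2 ^ p)" for p by simp
  then show ?thesis by (auto simp: flip_qbit_def qbit_bit)
qed

definition amp_of :: "complex vec \<Rightarrow> amp" where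
  "amp_of v z = (if z < dim_vec v then v $ z else 0)"

lemma agree_off_bit:
  fixes r c :: nat
  assumes "q < N" "r < 2 ^ N" "c < 2 ^ N"
  shows "(\<forall>p<N. p \<noteq> q \<longrightarrow> qbit N p r = qbit N p c) \<longleftrightarrow> c = r \<or> c = flip_bit (N - 1 - q) r"
    (is "?L \<longleftrightarrow> ?R")
proof
  assume L: ?L
  have *: "bit r s = bit c s" if "s \<noteq> N - 1 - q" for s
  proof (cases "s < N")
    case True
    then have "qbit N (N - 1 - s) r = qbit N (N - 1 - s) c" using L that assms(1) by auto
    then show ?thesis using True by (simp add: qbit_bit of_bool_eq_iff)
  next
    case False
    then show ?thesis using assms by (simp add: less_power2_iff_bit)
  qed
  show ?R
  proof (cases "bit r (N - 1 - q) = bit c (N - 1 - q)")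
    case True
    then have "c = r" using * by (metis bit_eqI)
    then show ?thesis ..
  next
    case False
    have "c = flip_bit (N - 1 - q) r"
      by (rule bit_eqI) (use False * in \<open>auto simp: bit_flip_bit_nat\<close>)
    then show ?thesis ..
  qed
next
  assume ?R
  then show ?L using assms(1) by (auto simp: qbit_bit bit_flip_bit_nat split: if_splits)
qed

lemma sum_two_points:
  fixes f :: "nat \<Rightarrow> complex"
  assumes "a < n" "b < n" "a \<noteq> b"
  shows "(\<Sum>c<n. if c = a \<or> c = b then f c else 0) = f a + f b"
proof -
  have "(\<Sum>c<n. if c = a \<or> c = b then f c else 0) = (\<Sum>c\<in>{a, b}. f c)"
    by (rule sum.mono_neutral_cong_right) (use assms in auto)
  then show ?thesis using assms by simp
qed

lemma single_qubit_mat_app: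
  assumes "q < N" "dim_vec v = 2 ^ N"
  shows "amp_of (single_qubit_mat N q G *\<^sub>v v) =
    loc (N - 1 - q) (\<lambda>_. (G $$ (0,0), G $$ (0,1), G $$ (1,0), G $$ (1,1))) (amp_of v)"
proof
  fix r
  let ?p = "N - 1 - q"
  have p: "?p < N" using assms by simp
  show "amp_of (single_qubit_mat N q G *\<^sub>v v) r =
    loc ?p (\<lambda>_. (G $$ (0,0), G $$ (0,1), G $$ (1,0), G $$ (1,1))) (amp_of v) r"
  proof (cases "r < 2 ^ N")
    case r: True
    then have fr: "flip_bit ?p r < 2 ^ N" using p by simp
    have "amp_of (single_qubit_mat N q G *\<^sub>v v) r = (\<Sum>c<2^N. single_qubit_mat N q G $$ (r, c) * v $ c)"
      using r assms by (simp add: amp_of_def single_qubit_mat_def scalar_prod_def atLeast0LessThan)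
    also have "\<dots> = (\<Sum>c<2^N. if c = r \<or> c = flip_bit ?p r then G $$ (qbit N q r, qbit N q c) * v $ c else 0)"
      by (rule sum.cong) (use r assms in \<open>auto simp: single_qubit_mat_def agree_off_bit\<close>)
    also have "\<dots> = G $$ (qbit N q r, qbit N q r) * v $ r + G $$ (qbit N q r, qbit N q (flip_bit ?p r)) * v $ flip_bit ?p r"
      by (rule sum_two_points) (use r fr in auto)
    also have "\<dots> = loc ?p (\<lambda>_. (G $$ (0,0), G $$ (0,1), G $$ (1,0), G $$ (1,1))) (amp_of v) r"
      using r fr assms by (simp add: loc_def amp_of_def qbit_bit bit_flip_bit_nat)
    finally show ?thesis .
  next
    case False
    then show ?thesis using assms p by (simp add: amp_of_def loc_def single_qubit_mat_def)
  qed
qed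

lemma cx_mat_app:
  assumes "c < N" "t < N" "c \<noteq> t" "dim_vec v = 2 ^ N"
  shows "amp_of (cx_mat N c t *\<^sub>v v) =
    loc (N - 1 - t) (\<lambda>z. if bit z (N - 1 - c) then m2_X else \<one>\<^sub>2) (amp_of v)"
proof
  fix r
  let ?p = "N - 1 - t"
  let ?s = "\<lambda>z::nat. if bit z (N - 1 - c) then flip_bit ?p z else z"
  have p: "?p < N" "N - 1 - c \<noteq> ?p" using assms by auto
  \<comment> \<open>The permutation is an involution, so the single 1 in row \<open>r\<close> sits
    in column \<open>?s r\<close>.\<close>
  have inv: "r = ?s x \<longleftrightarrow> x = ?s r" for r x
    using p by (auto simp: bit_flip_bit_nat)
  show "amp_of (cx_mat N c t *\<^sub>v v) r =
    loc ?p (\<lambda>z. if bit z (N - 1 - c) then m2_X else \<one>\<^sub>2) (amp_of v) r"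
  proof (cases "r < 2 ^ N")
    case r: True
    then have sr: "?s r < 2 ^ N" using p by simp
    have "amp_of (cx_mat N c t *\<^sub>v v) r = (\<Sum>x<2^N. cx_mat N c t $$ (r, x) * v $ x)"
      using r assms by (simp add: amp_of_def cx_mat_def scalar_prod_def atLeast0LessThan)
    also have "\<dots> = (\<Sum>x<2^N. if x = ?s r then v $ x else 0)"
    proof (rule sum.cong)
      fix x :: nat assume "x \<in> {..<2^N}"
      then have "cx_mat N c t $$ (r, x) = (if r = ?s x then 1 else 0)"
        using r by (simp add: cx_mat_def qbit_bit flip_qbit_flip_bit)
      then show "cx_mat N c t $$ (r, x) * v $ x = (if x = ?s r then v $ x else 0)"
        unfolding inv by simp
    qed simp
    also have "\<dots> = v $ ?s r" using sr by (subst sum.delta) auto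
    also have "\<dots> = loc ?p (\<lambda>z. if bit z (N - 1 - c) then m2_X else \<one>\<^sub>2) (amp_of v) r"
      using r sr assms by (auto simp: loc_def amp_of_def)
    finally show ?thesis .
  next
    case False
    then show ?thesis using assms p by (auto simp: amp_of_def loc_def cx_mat_def)
  qed
qed

lemma gate_mat_dim [simp]: "gate_mat n N g \<in> carrier_mat (2 ^ N) (2 ^ N)"
  by (cases g) (auto simp only: gate_mat.simps single_qubit_mat_def cx_mat_def mat_carrier)

lemma gate_mat_app:
  assumes "gate_ok N g" "dim_vec v = 2 ^ N"
  shows "amp_of (gate_mat 16 N g *\<^sub>v v) = gapp N g (amp_of v)"
proof (cases g)
  case (H q)
  then show ?thesis using assms by (simp add: single_qubit_mat_app H_gate_def)
next
  case (S q)
  then show ?thesis using assms by (simp add: single_qubit_mat_app S_gate_def)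
next
  case (T q)
  then show ?thesis using assms by (simp add: single_qubit_mat_app T_gate_def)
next
  case (CX c t)
  then show ?thesis using assms by (simp add: cx_mat_app)
qed

lemma circuit_mat_app:
  assumes "circuit_ok N C" "dim_vec v = 2 ^ N"
  shows "amp_of (circuit_mat 16 N C *\<^sub>v v) = capp N C (amp_of v)"
proof -
  have "amp_of (foldl (\<lambda>M g. gate_mat 16 N g * M) A C *\<^sub>v v) = fold (gapp N) C (amp_of (A *\<^sub>v v))"
    if "A \<in> carrier_mat (2 ^ N) (2 ^ N)" for A
    using assms(1) that
  proof (induction C arbitrary: A)
    case (Cons g C)
    have v: "v \<in> carrier_vec (2 ^ N)" by (rule carrier_vecI) (rule assms(2))
    have A: "A \<in> carrier_mat (2 ^ N) (2 ^ N)" by (rule Cons.prems(2))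
    have ok: "gate_ok N g" "circuit_ok N C" using Cons.prems(1) by (simp_all add: circuit_ok_def)
    have "amp_of (gate_mat 16 N g *\<^sub>v (A *\<^sub>v v)) = gapp N g (amp_of (A *\<^sub>v v))"
      using ok(1) by (rule gate_mat_app) (simp add: carrier_matD(1)[OF A])
    moreover note Cons.IH[OF ok(2) mult_carrier_mat[OF gate_mat_dim A, of 16 g]]
    ultimately show ?case by (simp only: foldl.simps fold.simps o_apply assoc_mult_mat_vec[OF gate_mat_dim A v])
  qed (simp only: foldl.simps fold.simps id_apply)
  from this[OF one_carrier_mat] show ?thesis
    unfolding circuit_mat_def capp_def one_mult_mat_vec[OF carrier_vecI[OF assms(2)]] .
qed

lemma circuit_mat_dim: "circuit_mat n N C \<in> carrier_mat (2 ^ N) (2 ^ N)"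
proof -
  have "A \<in> carrier_mat (2 ^ N) (2 ^ N) \<Longrightarrow>
    foldl (\<lambda>M g. gate_mat n N g * M) A C \<in> carrier_mat (2 ^ N) (2 ^ N)" for A
  proof (induction C arbitrary: A)
    case (Cons g C)
    show ?case using Cons.IH[OF mult_carrier_mat[OF gate_mat_dim Cons.prems]] by (simp only: foldl.simps)
  qed (simp only: foldl.simps)
  then show ?thesis unfolding circuit_mat_def using one_carrier_mat by blast
qed

lemma amp_of_inject: "dim_vec u = dim_vec v \<Longrightarrow> amp_of u = amp_of v \<Longrightarrow> u = v"
  by (rule eq_vecI) (metis (full_types) amp_of_def)

definition kron0 :: "nat \<Rightarrow> complex vec \<Rightarrow> amp" where
  "kron0 a v z = (if z mod 2 ^ a = 0 \<and> z div 2 ^ a < dim_vec v then v $ (z div 2 ^ a) else 0)"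

lemma kron_vec_amp: "amp_of (kron_vec v (unit_vec (2 ^ a) 0)) = kron0 a v"
proof
  fix z
  have "z < dim_vec v * 2 ^ a \<longleftrightarrow> z div 2 ^ a < dim_vec v"
    by (simp add: div_less_iff_less_mult)
  then show "amp_of (kron_vec v (unit_vec (2 ^ a) 0)) z = kron0 a v z"
    by (auto simp: amp_of_def kron_vec_def kron0_def)
qed

lemma exactly_represented_iff:
  assumes "U \<in> carrier_mat (2 ^ m) (2 ^ m)"
  shows "exactly_represented 16 m a U \<longleftrightarrow> (\<exists>C. circuit_ok (m + a) C \<and>
    (\<forall>u\<in>carrier_vec (2 ^ m). capp (m + a) C (kron0 a u) = kron0 a (U *\<^sub>v u)))"
proof -
  have "circuit_mat 16 (m + a) C *\<^sub>v kron_vec u (unit_vec (2 ^ a) 0) = kron_vec (U *\<^sub>v u) (unit_vec (2 ^ a) 0)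
      \<longleftrightarrow> capp (m + a) C (kron0 a u) = kron0 a (U *\<^sub>v u)"
    if C: "circuit_ok (m + a) C" and u: "u \<in> carrier_vec (2 ^ m)" for C u
  proof -
    have d: "dim_vec (kron_vec u (unit_vec (2 ^ a) 0)) = 2 ^ (m + a)"
      "dim_vec (kron_vec (U *\<^sub>v u) (unit_vec (2 ^ a) 0)) = 2 ^ (m + a)"
      using u assms by (simp_all add: kron_vec_def power_add)
    let ?L = "circuit_mat 16 (m + a) C *\<^sub>v kron_vec u (unit_vec (2 ^ a) 0)"
    let ?R = "kron_vec (U *\<^sub>v u) (unit_vec (2 ^ a) 0)"
    have "dim_vec ?L = dim_vec ?R" using circuit_mat_dim[of 16 "m + a" C] by (simp only: d dim_mult_mat_vec carrier_matD)
    then have "?L = ?R \<longleftrightarrow> amp_of ?L = amp_of ?R" using amp_of_inject[of ?L ?R] by argo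
    then show ?thesis by (simp only: circuit_mat_app[OF C d(1)] kron_vec_amp)
  qed
  then show ?thesis unfolding exactly_represented_def
    by (intro ex_cong1 conj_cong ball_cong refl) simp
qed

subsection \<open>Every circuit is unitary over the ring\<close>

definition ip :: "nat \<Rightarrow> amp \<Rightarrow> amp \<Rightarrow> complex" where
  "ip D f g = (\<Sum>z<D. cnj (f z) * g z)"

fun m2_unitary :: "m2 \<Rightarrow> bool" where
  "m2_unitary (a, b, c, d) \<longleftrightarrow> cnj a * a + cnj c * c = 1 \<and> cnj b * b + cnj d * d = 1 \<and>
     cnj a * b + cnj c * d = 0"

lemma m2_unitary_ip:
  assumes "m2_unitary (a, b, c, d)"
  shows "cnj (a * x + b * y) * (a * x' + b * y') + cnj (c * x + d * y) * (c * x' + d * y') = cnj x * x' + cnj y * y'"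
proof -
  have u: "cnj a * a + cnj c * c = 1" "cnj b * b + cnj d * d = 1" "cnj a * b + cnj c * d = 0"
    using assms by simp_all
  have u': "a * cnj b + c * cnj d = 0" using arg_cong[OF u(3), of cnj] by simp
  have "cnj (a * x + b * y) * (a * x' + b * y') + cnj (c * x + d * y) * (c * x' + d * y') =
    (cnj a * a + cnj c * c) * (cnj x * x') + (cnj b * b + cnj d * d) * (cnj y * y') +
    (cnj a * b + cnj c * d) * (cnj x * y') + (a * cnj b + c * cnj d) * (cnj y * x')"
    by (simp add: algebra_simps)
  then show ?thesis unfolding u u' by simp
qed

lemma bij_betw_flip_bit: "p < N \<Longrightarrow> bij_betw (flip_bit p) {..<2 ^ N :: nat} {..<2 ^ N}"
  by (rule bij_betw_byWitness[where f' = "flip_bit p"]) auto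

text \<open>Unitarity of a local gate is an identity about pairs of amplitudes. Doubling the sum
  turns it into a sum over pairs, where that identity applies termwise.\<close>

lemma sum_flip_bit:
  fixes h :: amp
  assumes "p < N"
  shows "2 * (\<Sum>z<2^N. h z) = (\<Sum>z<2^N. h z + h (flip_bit p z))"
  using sum.reindex_bij_betw[OF bij_betw_flip_bit[OF assms], of h] by (simp add: sum.distrib)

lemma loc_ip:
  assumes p: "p < N" and inv: "\<And>z. M (flip_bit p z) = M z" and u: "\<And>z. m2_unitary (M z)"
  shows "ip (2 ^ N) (loc p M f) (loc p M g) = ip (2 ^ N) f g"
proof -
  have "cnj (loc p M f z) * loc p M g z + cnj (loc p M f (flip_bit p z)) * loc p M g (flip_bit p z) =
    cnj (f z) * g z + cnj (f (flip_bit p z)) * g (flip_bit p z)" for z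
  proof -
    obtain a b c d where M: "M z = (a, b, c, d)" by (metis prod.exhaust)
    have "m2_unitary (a, b, c, d)" using u[of z] M by simp
    note * = m2_unitary_ip[OF this]
    show ?thesis
    proof (cases "bit z p")
      case True
      then show ?thesis using *[of "f (flip_bit p z)" "f z" "g (flip_bit p z)" "g z"]
        by (simp add: loc_def inv M bit_flip_bit_nat ac_simps)
    next
      case False
      then show ?thesis using *[of "f z" "f (flip_bit p z)" "g z" "g (flip_bit p z)"]
        by (simp add: loc_def inv M bit_flip_bit_nat ac_simps)
    qed
  qed
  then have "2 * ip (2 ^ N) (loc p M f) (loc p M g) = 2 * ip (2 ^ N) f g"
    unfolding ip_def sum_flip_bit[OF p] by (intro sum.cong refl)
  then show ?thesis by simp
qed

lemma gapp_ip:
  assumes "gate_ok N g"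
  shows "ip (2 ^ N) (gapp N g f) (gapp N g f') = ip (2 ^ N) f f'"
proof (cases g)
  case (H q)
  then show ?thesis using assms rt2_squared
    by (auto intro!: loc_ip simp: field_simps)
next
  case (S q)
  then show ?thesis using assms by (auto intro!: loc_ip)
next
  case (T q)
  then show ?thesis using assms by (auto intro!: loc_ip)
next
  case (CX c t)
  then show ?thesis using assms by (auto intro!: loc_ip simp: bit_flip_bit_nat)
qed

lemma capp_ip: "circuit_ok N C \<Longrightarrow> ip (2 ^ N) (capp N C f) (capp N C g) = ip (2 ^ N) f g"
  by (induction C arbitrary: f g) (simp_all add: capp_def circuit_ok_def gapp_ip)

fun m2_ring :: "nat \<Rightarrow> m2 \<Rightarrow> bool" where
  "m2_ring n (a, b, c, d) \<longleftrightarrow> a \<in> ring_R n \<and> b \<in> ring_R n \<and> c \<in> ring_R n \<and> d \<in> ring_R n"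

lemma loc_ring:
  assumes "\<And>z. m2_ring n (M z)" "\<And>z. f z \<in> ring_R n"
  shows "loc p M f z \<in> ring_R n"
proof -
  obtain a b c d where "M z = (a, b, c, d)" by (metis prod.exhaust)
  then show ?thesis using assms(1)[of z] assms(2)
    by (auto simp: loc_def intro!: ring_R.add ring_R.mult)
qed

lemma gapp_ring: "(\<And>z. f z \<in> ring_R 16) \<Longrightarrow> gapp N g f z \<in> ring_R 16"
  using ring_R_8_consts[THEN ring_R_8_16] ring_R.neg[OF ring_R_8_consts(1)[THEN ring_R_8_16]]
  by (cases g) (auto intro!: loc_ring intro: ring_R.one ring_R.zeta)

lemma capp_ring: "(\<And>z. f z \<in> ring_R 16) \<Longrightarrow> capp N C f z \<in> ring_R 16"
  by (induction C arbitrary: f z) (simp_all add: capp_def gapp_ring)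

lemma kron0_ip:
  assumes "u \<in> carrier_vec (2 ^ m)" "v \<in> carrier_vec (2 ^ m)"
  shows "ip (2 ^ (m + a)) (kron0 a u) (kron0 a v) = (\<Sum>i<2 ^ m. cnj (u $ i) * v $ i)"
proof -
  have "(\<Sum>i<2 ^ m. cnj (u $ i) * v $ i) = (\<Sum>z\<in>(\<lambda>i. i * 2 ^ a) ` {..<2 ^ m}. cnj (kron0 a u z) * kron0 a v z)"
    using assms by (subst sum.reindex) (auto simp: inj_on_def kron0_def)
  also have "\<dots> = ip (2 ^ (m + a)) (kron0 a u) (kron0 a v)"
    unfolding ip_def
  proof (rule sum.mono_neutral_left)
    show "(\<lambda>i. i * 2 ^ a) ` {..<2 ^ m} \<subseteq> {..<2 ^ (m + a) :: nat}" by (auto simp: power_add)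
    show "\<forall>z\<in>{..<2 ^ (m + a)} - (\<lambda>i. i * 2 ^ a) ` {..<2 ^ m}. cnj (kron0 a u z) * kron0 a v z = 0"
    proof
      fix z :: nat assume z: "z \<in> {..<2 ^ (m + a)} - (\<lambda>i. i * 2 ^ a) ` {..<2 ^ m}"
      have "z mod 2 ^ a \<noteq> 0"
      proof
        assume "z mod 2 ^ a = 0"
        then have "z = (z div 2 ^ a) * 2 ^ a" by (metis add.right_neutral div_mult_mod_eq)
        moreover have "z div 2 ^ a < 2 ^ m" using z by (simp add: power_add div_less_iff_less_mult)
        ultimately show False using z by blast
      qed
      then show "cnj (kron0 a u z) * kron0 a v z = 0" by (simp add: kron0_def)
    qed
  qed simp
  finally show ?thesis by simp
qed

text \<open>The columns of \<open>U\<close> are the outputs on basis states. They inherit ring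
  entries and orthonormality from the whole register, because all their amplitude lies on the
  ancilla value 0.\<close>

lemma represented_imp_unitary_ring:
  assumes U: "U \<in> carrier_mat (2 ^ m) (2 ^ m)" and rep: "exactly_represented 16 m a U"
  shows "unitary U" and "i < 2 ^ m \<Longrightarrow> j < 2 ^ m \<Longrightarrow> U $$ (i, j) \<in> ring_R 16"
proof -
  obtain C where C: "circuit_ok (m + a) C"
    and CU: "\<And>u. u \<in> carrier_vec (2 ^ m) \<Longrightarrow> capp (m + a) C (kron0 a u) = kron0 a (U *\<^sub>v u)"
    using rep unfolding exactly_represented_iff[OF U] by blast
  let ?n = "2 ^ m :: nat"
  have col: "capp (m + a) C (kron0 a (unit_vec ?n j)) = kron0 a (col U j)" if "j < ?n" for j
  proof -
    have "U *\<^sub>v unit_vec ?n j = col U j"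
      by (rule eq_vecI) (use U that in \<open>simp_all add: scalar_prod_right_unit[of _ ?n]\<close>)
    then show ?thesis using CU[of "unit_vec ?n j"] by simp
  qed
  show "U $$ (i, j) \<in> ring_R 16" if ij: "i < ?n" "j < ?n" for i j
  proof -
    have "kron0 a (unit_vec ?n j) z \<in> ring_R 16" for z
      by (auto simp: kron0_def unit_vec_def intro: ring_R.one)
    then have "kron0 a (col U j) (i * 2 ^ a) \<in> ring_R 16"
      unfolding col[OF ij(2), symmetric] by (rule capp_ring)
    then show ?thesis using U ij by (simp add: kron0_def)
  qed
  have "adjoint U * U = 1\<^sub>m ?n"
  proof (rule eq_matI)
    fix i j assume "i < dim_row (1\<^sub>m ?n :: complex mat)" "j < dim_col (1\<^sub>m ?n :: complex mat)"
    then have ij: "i < ?n" "j < ?n" by simp_all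
    have "(adjoint U * U) $$ (i, j) = (\<Sum>k<?n. cnj (col U i $ k) * col U j $ k)"
      using U ij by (simp add: adjoint_def scalar_prod_def atLeast0LessThan)
    also have "\<dots> = ip (2 ^ (m + a)) (kron0 a (col U i)) (kron0 a (col U j))"
      by (rule kron0_ip[symmetric]) (use U ij in auto)
    also have "\<dots> = ip (2 ^ (m + a)) (kron0 a (unit_vec ?n i)) (kron0 a (unit_vec ?n j))"
      by (simp only: col[OF ij(1), symmetric] col[OF ij(2), symmetric] capp_ip[OF C])
    also have "\<dots> = (\<Sum>k<?n. cnj (unit_vec ?n i $ k) * unit_vec ?n j $ k)"
      by (rule kron0_ip) auto
    also have "\<dots> = (\<Sum>k<?n. if k = j then cnj (unit_vec ?n i $ j) else 0)"
      by (rule sum.cong) (use ij in auto)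
    also have "\<dots> = 1\<^sub>m ?n $$ (i, j)" using ij by simp
    finally show "(adjoint U * U) $$ (i, j) = 1\<^sub>m ?n $$ (i, j)" .
  qed (use U in \<open>auto simp: adjoint_def\<close>)
  moreover have "adjoint U \<in> carrier_mat ?n ?n" using U by (simp add: adjoint_def)
  ultimately have "U * adjoint U = 1\<^sub>m ?n" using mat_mult_left_right_inverse U by blast
  then show "unitary U" using \<open>adjoint U * U = 1\<^sub>m ?n\<close> U by (simp add: unitary_def)
qed

subsection \<open>Controlled gates\<close>

definition circuit_op :: "nat \<Rightarrow> (amp \<Rightarrow> amp) \<Rightarrow> bool" where
  "circuit_op N F \<longleftrightarrow> (\<exists>C. circuit_ok N C \<and> capp N C = F)"

lemma circuit_op_comp: "circuit_op N F \<Longrightarrow> circuit_op N G \<Longrightarrow> circuit_op N (\<lambda>f. F (G f))"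
proof -
  assume "circuit_op N F" "circuit_op N G"
  then obtain A B where AB: "circuit_ok N A" "capp N A = F" "circuit_ok N B" "capp N B = G"
    unfolding circuit_op_def by blast
  have "circuit_ok N (B @ A)" using AB by (auto simp: circuit_ok_def)
  moreover have "capp N (B @ A) = (\<lambda>f. F (G f))"
    unfolding AB(2,4)[symmetric] by (simp add: capp_def fun_eq_iff)
  ultimately show ?thesis unfolding circuit_op_def by blast
qed

lemma circuit_op_id: "circuit_op N (\<lambda>f. f)"
  unfolding circuit_op_def by (rule exI[of _ "[]"]) (simp add: circuit_ok_def capp_def fun_eq_iff)

lemma circuit_op_gate: "gate_ok N g \<Longrightarrow> circuit_op N (gapp N g)"
  unfolding circuit_op_def by (rule exI[of _ "[g]"]) (simp add: circuit_ok_def capp_def fun_eq_iff)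

definition ctrl :: "nat \<Rightarrow> (nat \<Rightarrow> bool) \<Rightarrow> m2 \<Rightarrow> amp \<Rightarrow> amp" where
  "ctrl t P M = loc t (\<lambda>z. if P z then M else \<one>\<^sub>2)"

lemma circuit_op_H: "p < N \<Longrightarrow> circuit_op N (loc p (\<lambda>_. m2_H))"
  using circuit_op_gate[of N "H (N - 1 - p)"] by simp

lemma circuit_op_T: "p < N \<Longrightarrow> circuit_op N (loc p (\<lambda>_. m2_diag 1 \<zeta>))"
  using circuit_op_gate[of N "T (N - 1 - p)"] by simp

lemma circuit_op_CX: "c < N \<Longrightarrow> t < N \<Longrightarrow> c \<noteq> t \<Longrightarrow> circuit_op N (ctrl t (\<lambda>z. bit z c) m2_X)"
  using circuit_op_gate[of N "CX (N - 1 - c) (N - 1 - t)"] by (simp add: ctrl_def)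

lemma circuit_op_phase: "p < N \<Longrightarrow> circuit_op N (loc p (\<lambda>_. m2_diag 1 (\<zeta> ^ k)))"
proof (induction k)
  case 0
  then show ?case using circuit_op_id by (simp add: loc_id)
next
  case (Suc k)
  then show ?case using circuit_op_comp[OF circuit_op_T[of p N] Suc.IH] by (simp add: loc_comp)
qed

lemma half_sum: "1 / (rt2 * rt2) = 1 / 2"
  by (simp only: rt2_squared)

lemma circuit_op_conj_H:
  assumes "p < N" "\<And>z. P (flip_bit p z) = P z" "circuit_op N (ctrl p P M)"
  shows "circuit_op N (ctrl p P (m2_H \<odot> M \<odot> m2_H))"
proof -
  have "loc p (\<lambda>_. m2_H) (ctrl p P M (loc p (\<lambda>_. m2_H) f)) = ctrl p P (m2_H \<odot> M \<odot> m2_H) f" for f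
  proof -
    have "(\<lambda>z. m2_H \<odot> ((if P z then M else \<one>\<^sub>2) \<odot> m2_H)) = (\<lambda>z. if P z then m2_H \<odot> M \<odot> m2_H else \<one>\<^sub>2)"
      by (cases M) (auto simp: fun_eq_iff half_sum algebra_simps)
    then show ?thesis unfolding ctrl_def by (simp add: loc_comp assms(2) del: m2_mult.simps)
  qed
  moreover have "circuit_op N (\<lambda>f. loc p (\<lambda>_. m2_H) (ctrl p P M (loc p (\<lambda>_. m2_H) f)))"
    by (rule circuit_op_comp[OF circuit_op_H[OF assms(1)] circuit_op_comp[OF assms(3) circuit_op_H[OF assms(1)]]])
  ultimately show ?thesis by simp
qed

lemma circuit_op_ctrl_comp:
  assumes "\<And>z. P (flip_bit p z) = P z" "circuit_op N (ctrl p P A)" "circuit_op N (ctrl p P B)"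
  shows "circuit_op N (ctrl p P (A \<odot> B))"
proof -
  have "ctrl p P A (ctrl p P B f) = ctrl p P (A \<odot> B) f" for f
  proof -
    have "(\<lambda>z. (if P z then A else \<one>\<^sub>2) \<odot> (if P z then B else \<one>\<^sub>2)) = (\<lambda>z. if P z then A \<odot> B else \<one>\<^sub>2)"
      by (auto simp: fun_eq_iff)
    then show ?thesis unfolding ctrl_def by (simp add: loc_comp assms(1) del: m2_mult.simps)
  qed
  then show ?thesis using circuit_op_comp[OF assms(2,3)] by simp
qed

lemma H_Z_H: "m2_H \<odot> m2_diag 1 (- 1) \<odot> m2_H = m2_X"
  by (simp add: half_sum)

lemma circuit_op_X: "p < N \<Longrightarrow> circuit_op N (ctrl p (\<lambda>_. True) m2_X)"
  using circuit_op_conj_H[of p N "\<lambda>_. True" "m2_diag 1 (- 1)"] circuit_op_phase[of p N 8]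
  unfolding H_Z_H by (simp add: ctrl_def zeta_power8)

text \<open>With \<open>V = diag(1, v)\<close> the matrix \<open>V X V\<^sup>-\<^sup>1 X\<close> is \<open>diag(v\<^sup>-\<^sup>1, v)\<close>, so the group commutator of the
  involutions \<open>V X V\<^sup>-\<^sup>1\<close> and \<open>X\<close> is its square; it fires only when both controls do.\<close>
lemma circuit_op_phase_commutator:
  assumes t: "t < N" and P: "\<And>z. P (flip_bit t z) = P z" and Q: "\<And>z. Q (flip_bit t z) = Q z"
    and iP: "circuit_op N (ctrl t P m2_X)" and iQ: "circuit_op N (ctrl t Q m2_X)"
  shows "circuit_op N (ctrl t (\<lambda>z. P z \<and> Q z) (m2_diag (cnj \<omega> ^ k) (\<omega> ^ k)))"
proof -
  define v where "v = \<zeta> ^ k"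
  \<comment> \<open>The inverse of \<open>v\<close>, written with a nonnegative exponent because
    only the gate T itself is available, not its inverse.\<close>
  define u where "u = \<zeta> ^ (15 * k)"
  have uv: "u * v = 1" "v * u = 1"
  proof -
    have "u * v = (\<zeta> ^ 16) ^ k" unfolding u_def v_def by (simp flip: power_add power_mult)
    then show "u * v = 1" "v * u = 1" by (simp_all add: zeta_power16 mult.commute)
  qed
  have v2: "v * v = \<omega> ^ k"
    unfolding v_def zeta_squared[symmetric] by (simp add: power2_eq_square power_mult_distrib)
  have "cnj \<zeta> * cnj \<zeta> = cnj \<omega>" unfolding zeta_squared[symmetric] by (simp add: power2_eq_square)
  then have u2: "u * u = cnj \<omega> ^ k"
    unfolding u_def power_mult cnj_zeta[symmetric] by (simp flip: power_mult_distrib)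
  let ?V = "loc t (\<lambda>_. m2_diag 1 v)" and ?U = "loc t (\<lambda>_. m2_diag 1 u)"
  let ?P = "ctrl t P m2_X" and ?Q = "ctrl t Q m2_X"
  have V: "circuit_op N ?V" "circuit_op N ?U" unfolding u_def v_def using t by (auto intro: circuit_op_phase)
  have "circuit_op N (\<lambda>f. ?V (?P (?U (?Q (?V (?P (?U (?Q f))))))))"
    by (rule circuit_op_comp[OF V(1) circuit_op_comp[OF iP circuit_op_comp[OF V(2) circuit_op_comp[OF iQ
          circuit_op_comp[OF V(1) circuit_op_comp[OF iP circuit_op_comp[OF V(2) iQ]]]]]]])
  moreover have "?V (?P (?U (?Q (?V (?P (?U (?Q f))))))) =
      ctrl t (\<lambda>z. P z \<and> Q z) (m2_diag (cnj \<omega> ^ k) (\<omega> ^ k)) f" for f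
  proof -
    let ?p = "\<lambda>z. if P z then m2_X else \<one>\<^sub>2" and ?q = "\<lambda>z. if Q z then m2_X else \<one>\<^sub>2"
    let ?v = "m2_diag 1 v" and ?u = "m2_diag 1 u"
    have "(\<lambda>z. ?v \<odot> (?p z \<odot> (?u \<odot> (?q z \<odot> (?v \<odot> (?p z \<odot> (?u \<odot> ?q z))))))) =
      (\<lambda>z. if P z \<and> Q z then m2_diag (cnj \<omega> ^ k) (\<omega> ^ k) else \<one>\<^sub>2)"
      using uv by (auto simp: fun_eq_iff v2[symmetric] u2[symmetric])
    then show ?thesis unfolding ctrl_def by (simp add: loc_comp P Q del: m2_mult.simps)
  qed
  ultimately show ?thesis by simp
qed

text \<open>The commutator of CX and X gives a controlled
  \<open>diag(cnj \<omega>, \<omega>)\<close>; a phase \<omega> on the control turns this into a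
  controlled \<open>diag(1, \<i>)\<close>.\<close>

lemma circuit_op_CS:
  assumes "a < N" "b < N" "a \<noteq> b"
  shows "circuit_op N (ctrl b (\<lambda>z. bit z a) (m2_diag 1 \<i>))"
proof -
  have "circuit_op N (ctrl b (\<lambda>z. bit z a \<and> True) (m2_diag (cnj \<omega> ^ 1) (\<omega> ^ 1)))"
    using assms by (intro circuit_op_phase_commutator circuit_op_CX circuit_op_X) (auto simp: bit_flip_bit_nat)
  then have "circuit_op N (\<lambda>f. loc a (\<lambda>_. m2_diag 1 (\<zeta> ^ 2)) (ctrl b (\<lambda>z. bit z a) (m2_diag (cnj \<omega>) \<omega>) f))"
    using circuit_op_comp[OF circuit_op_phase[OF assms(1), of 2]] by simp
  also have "(\<lambda>f. loc a (\<lambda>_. m2_diag 1 (\<zeta> ^ 2)) (ctrl b (\<lambda>z. bit z a) (m2_diag (cnj \<omega>) \<omega>) f)) =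
      ctrl b (\<lambda>z. bit z a) (m2_diag 1 \<i>)"
    unfolding zeta_squared omega_squared[symmetric]
    by (auto simp: fun_eq_iff ctrl_def loc_def power2_eq_square simp flip: mult.assoc)
  finally show ?thesis .
qed

text \<open>The commutator of two CX gates gives a doubly controlled
  \<open>diag(-\<i>, \<i>)\<close>. A controlled S between the two controls multiplies it by \<i>,
  giving a doubly controlled \<open>diag(1, -1)\<close>, and Hadamard gates on the target turn this
  into X.\<close>

lemma circuit_op_CCX:
  assumes "a < N" "b < N" "t < N" "a \<noteq> b" "a \<noteq> t" "b \<noteq> t"
  shows "circuit_op N (ctrl t (\<lambda>z. bit z a \<and> bit z b) m2_X)"
proof -
  have "circuit_op N (ctrl t (\<lambda>z. bit z a \<and> bit z b) (m2_diag (cnj \<omega> ^ 2) (\<omega> ^ 2)))"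
    using assms by (intro circuit_op_phase_commutator circuit_op_CX) (auto simp: bit_flip_bit_nat)
  then have "circuit_op N (\<lambda>f. ctrl b (\<lambda>z. bit z a) (m2_diag 1 \<i>) (ctrl t (\<lambda>z. bit z a \<and> bit z b) (m2_diag (cnj \<omega> ^ 2) (\<omega> ^ 2)) f))"
    using circuit_op_comp[OF circuit_op_CS[OF assms(1,2,4)]] by blast
  also have "(\<lambda>f. ctrl b (\<lambda>z. bit z a) (m2_diag 1 \<i>) (ctrl t (\<lambda>z. bit z a \<and> bit z b) (m2_diag (cnj \<omega> ^ 2) (\<omega> ^ 2)) f)) =
      ctrl t (\<lambda>z. bit z a \<and> bit z b) (m2_diag 1 (- 1))"
  proof -
    have "cnj \<omega> ^ 2 = - \<i>" using arg_cong[OF omega_squared, of cnj] by simp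
    then show ?thesis unfolding omega_squared
      by (auto simp: fun_eq_iff ctrl_def loc_def simp flip: mult.assoc)
  qed
  finally show ?thesis
    using circuit_op_conj_H[of t N "\<lambda>z. bit z a \<and> bit z b" "m2_diag 1 (- 1)"] assms
    unfolding H_Z_H by (simp add: bit_flip_bit_nat)
qed

text \<open>The bit \<open>b\<close> is borrowed: its value is arbitrary and is restored at the end.\<close>
lemma borrowed_commutator:
  assumes "b \<noteq> t" and P: "\<And>z. P (flip_bit t z) = P z" "\<And>z. P (flip_bit b z) = P z"
    and Q: "\<And>z. Q (flip_bit t z) = Q z" "\<And>z. Q (flip_bit b z) = Q z"
  shows "ctrl b P m2_X (ctrl t (\<lambda>z. Q z \<and> bit z b) m2_X (ctrl b P m2_X (ctrl t (\<lambda>z. Q z \<and> bit z b) m2_X f))) =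
    ctrl t (\<lambda>z. P z \<and> Q z) m2_X f"
proof
  fix z
  have [simp]: "flip_bit b (flip_bit t (flip_bit b z)) = flip_bit t z" for z :: nat
    using flip_bit_commute[of b t "flip_bit b z"] by simp
  have X: "ctrl t P m2_X g x = g (if P x then flip_bit t x else x)" for t P g x
    by (simp add: ctrl_def loc_def)
  show "ctrl b P m2_X (ctrl t (\<lambda>z. Q z \<and> bit z b) m2_X (ctrl b P m2_X (ctrl t (\<lambda>z. Q z \<and> bit z b) m2_X f))) z =
    ctrl t (\<lambda>z. P z \<and> Q z) m2_X f z"
    unfolding X using assms(1)
    by (cases "P z"; cases "Q z"; cases "bit z b") (simp_all add: P Q bit_flip_bit_nat flip_bit_commute[of t b])
qed

definition all_bits :: "nat set \<Rightarrow> nat \<Rightarrow> bool" where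
  "all_bits K z \<longleftrightarrow> (\<forall>q\<in>K. bit z q)"

lemma all_bits_flip: "t \<notin> K \<Longrightarrow> all_bits K (flip_bit t z) = all_bits K z"
  by (auto simp: all_bits_def bit_flip_bit_nat)

lemma all_bits_insert: "all_bits (insert q K) = (\<lambda>z. all_bits K z \<and> bit z q)"
  by (auto simp: all_bits_def)

lemma all_bits_empty: "all_bits {} = (\<lambda>_. True)"
  by (simp add: all_bits_def fun_eq_iff)

text \<open>The bound on \<open>card K\<close> guarantees a qubit \<open>b\<close> that is neither
  control nor target. Two of the controls act on \<open>b\<close>, the others together with
  \<open>b\<close> act on the target; with at least three controls both gates have fewer than
  \<open>card K\<close> controls, and the borrowed commutator combines them.\<close>

lemma circuit_op_multi_CX:
  assumes "K \<subseteq> {..<N}" "t < N" "t \<notin> K" "card K + 2 \<le> N"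
  shows "circuit_op N (ctrl t (all_bits K) m2_X)"
  using assms
proof (induction "card K" arbitrary: K t rule: less_induct)
  case less
  have fin: "finite K" using less.prems(1) finite_subset by blast
  show ?case
  proof (cases "card K \<le> 2")
    case True
    then consider "K = {}" | c where "K = {c}" | a b where "K = {a, b}" "a \<noteq> b"
      using fin by (metis One_nat_def Suc_1 card_1_singletonE card_0_eq card_2_iff le_Suc_eq le_zero_eq)
    then show ?thesis
    proof cases
      case 1
      then show ?thesis using circuit_op_X less.prems(2) by (simp add: all_bits_empty)
    next
      case (2 c)
      then show ?thesis using circuit_op_CX[of c N t] less.prems by (auto simp: all_bits_insert all_bits_empty)
    next
      case (3 a b)
      then show ?thesis using circuit_op_CCX[of b N a t] less.prems by (auto simp: all_bits_insert all_bits_empty)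
    qed
  next
    case False
    then obtain A where A: "A \<subseteq> K" "card A = 2" by (meson nat_le_linear obtain_subset_with_card_n)
    define B where "B = K - A"
    have finAB: "finite A" "finite B" using fin A finite_subset by (auto simp: B_def)
    have cB: "card B + 2 = card K" using A finAB card_mono[OF fin A(1)] by (simp add: B_def card_Diff_subset)
    have "card (insert t K) < card {..<N}" using less.prems fin by simp
    then have "\<not> {..<N} \<subseteq> insert t K" using fin card_mono[of "insert t K" "{..<N}"] by auto
    then obtain b where b: "b < N" "b \<noteq> t" "b \<notin> K" by auto
    have bB: "b \<notin> B" "b \<notin> A" "t \<notin> A" "t \<notin> B" using b less.prems A by (auto simp: B_def)
    have cbB: "card (insert b B) + 1 = card K" using cB finAB bB by simp
    have 1: "circuit_op N (ctrl b (all_bits A) m2_X)"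
      by (rule less.hyps) (use A less.prems b False in auto)
    have "circuit_op N (ctrl t (all_bits (insert b B)) m2_X)"
      by (rule less.hyps) (use cbB less.prems b B_def in auto)
    then have 2: "circuit_op N (ctrl t (\<lambda>z. all_bits B z \<and> bit z b) m2_X)" by (simp add: all_bits_insert)
    have "circuit_op N (ctrl t (\<lambda>z. all_bits A z \<and> all_bits B z) m2_X)"
      using circuit_op_comp[OF 1 circuit_op_comp[OF 2 circuit_op_comp[OF 1 2]]] b(2) bB
      by (simp add: borrowed_commutator all_bits_flip)
    moreover have "(\<lambda>z. all_bits A z \<and> all_bits B z) = all_bits K"
      using A(1) by (auto simp: all_bits_def B_def fun_eq_iff)
    ultimately show ?thesis by simp
  qed
qed

text \<open>Both matrices have determinant 1; the second is the Hadamard matrix times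
  \<open>-\<i>\<close>, since the Hadamard matrix itself has determinant -1.\<close>

abbreviation m2_D :: m2 where "m2_D \<equiv> m2_diag (cnj \<omega>) \<omega>"
abbreviation m2_nH :: m2 where "m2_nH \<equiv> (- \<i> / rt2, - \<i> / rt2, - \<i> / rt2, \<i> / rt2)"

text \<open>Here no qubit is idle. Setting aside one control \<open>c\<close> leaves a multiply
  controlled X that can borrow \<open>c\<close>, and its commutator with the CX controlled by
  \<open>c\<close> restores the full set of controls.\<close>

lemma circuit_op_full_D:
  assumes "N \<ge> 2" "t < N"
  shows "circuit_op N (ctrl t (all_bits ({..<N} - {t})) m2_D)"
proof -
  define c where "c = (if t = 0 then 1 else 0 :: nat)"
  have c: "c < N" "c \<noteq> t" using assms by (auto simp: c_def)
  let ?K = "{..<N} - {t} - {c}"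
  have K: "insert c ?K = {..<N} - {t}" using c by auto
  have "card ?K + 2 = N" using assms c by simp
  then have "circuit_op N (ctrl t (all_bits ?K) m2_X)"
    by (intro circuit_op_multi_CX) (use assms in auto)
  then have "circuit_op N (ctrl t (\<lambda>z. all_bits ?K z \<and> bit z c) (m2_diag (cnj \<omega> ^ 1) (\<omega> ^ 1)))"
    using assms c by (intro circuit_op_phase_commutator circuit_op_CX) (auto simp: bit_flip_bit_nat all_bits_flip)
  then show ?thesis unfolding all_bits_insert[symmetric] K by simp
qed

text \<open>The Euler decomposition of the Hadamard matrix into quarter turns about the Z, X and Z
  axes, which fixes the factor \<open>-\<i>\<close>.\<close>

lemma nH_from_D: "m2_D \<odot> (m2_H \<odot> m2_D \<odot> m2_H) \<odot> m2_D = m2_nH"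
  by (simp add: omega_Complex complex_eq_iff field_simps)

lemma circuit_op_full_nH:
  assumes "N \<ge> 2" "t < N"
  shows "circuit_op N (ctrl t (all_bits ({..<N} - {t})) m2_nH)"
proof -
  note D = circuit_op_full_D[OF assms]
  have inv: "all_bits ({..<N} - {t}) (flip_bit t z) = all_bits ({..<N} - {t}) z" for z
    by (rule all_bits_flip) simp
  show ?thesis
    unfolding nH_from_D[symmetric] by (intro circuit_op_ctrl_comp D circuit_op_conj_H inv assms(2))
qed

subsection \<open>Two-level operators\<close>

fun lev2 :: "nat \<Rightarrow> nat \<Rightarrow> m2 \<Rightarrow> amp \<Rightarrow> amp" where
  "lev2 x y (a, b, c, d) f = f(x := a * f x + b * f y, y := c * f x + d * f y)"

text \<open>Gates also act on amplitudes at indices beyond the register, where the controls see the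
  same low bits again. A two-level operator can therefore be matched only on states that vanish
  there.\<close>

definition circuit_op_on :: "nat \<Rightarrow> (amp \<Rightarrow> amp) \<Rightarrow> bool" where
  "circuit_op_on N F \<longleftrightarrow> (\<exists>C. circuit_ok N C \<and> (\<forall>f. supp N f \<longrightarrow> capp N C f = F f))"

lemma circuit_op_circuit_op_on: "circuit_op N F \<Longrightarrow> circuit_op_on N F"
  unfolding circuit_op_def circuit_op_on_def by blast

lemma circuit_op_on_supp: "circuit_op_on N F \<Longrightarrow> supp N f \<Longrightarrow> supp N (F f)"
  unfolding circuit_op_on_def using supp_capp by metis

lemma circuit_op_on_cong: "(\<And>f. supp N f \<Longrightarrow> F f = G f) \<Longrightarrow> circuit_op_on N F \<Longrightarrow> circuit_op_on N G"
  unfolding circuit_op_on_def by metis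

lemma circuit_op_on_comp: "circuit_op_on N F \<Longrightarrow> circuit_op_on N G \<Longrightarrow> circuit_op_on N (\<lambda>f. F (G f))"
proof -
  assume F: "circuit_op_on N F" and G: "circuit_op_on N G"
  from F obtain A where A: "circuit_ok N A" "\<And>f. supp N f \<Longrightarrow> capp N A f = F f"
    unfolding circuit_op_on_def by blast
  from G obtain B where B: "circuit_ok N B" "\<And>f. supp N f \<Longrightarrow> capp N B f = G f"
    unfolding circuit_op_on_def by blast
  have "circuit_ok N (B @ A)" using A B by (auto simp: circuit_ok_def)
  moreover have "capp N (B @ A) f = F (G f)" if "supp N f" for f
  proof -
    have "capp N (B @ A) f = capp N A (capp N B f)" by (simp add: capp_def)
    then show ?thesis using A(2)[OF circuit_op_on_supp[OF G that]] B(2)[OF that] by simp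
  qed
  ultimately show ?thesis unfolding circuit_op_on_def by blast
qed

lemma lev2_comp: "x \<noteq> y \<Longrightarrow> lev2 x y A (lev2 x y B f) = lev2 x y (A \<odot> B) f"
  by (cases A; cases B) (auto simp: fun_eq_iff algebra_simps)

lemma circuit_op_on_lev2_mult:
  "x \<noteq> y \<Longrightarrow> circuit_op_on N (lev2 x y A) \<Longrightarrow> circuit_op_on N (lev2 x y B) \<Longrightarrow> circuit_op_on N (lev2 x y (A \<odot> B))"
  by (rule circuit_op_on_cong[OF _ circuit_op_on_comp[of N "lev2 x y A" "lev2 x y B"]]) (auto simp: lev2_comp simp del: m2_mult.simps)

lemma bit_mask_nat: "bit (mask N :: nat) q \<longleftrightarrow> q < N"
  by (simp add: bit_mask_iff)

lemma mask_less: "(mask N :: nat) < 2 ^ N"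
  by (simp add: less_power2_iff_bit bit_mask_nat)

lemma all_bits_full_iff:
  assumes "t < N" "z < 2 ^ N"
  shows "all_bits ({..<N} - {t}) z \<longleftrightarrow> z = mask N \<or> z = flip_bit t (mask N)"
proof
  assume a: "all_bits ({..<N} - {t}) z"
  have b: "bit z q \<longleftrightarrow> q < N" if "q \<noteq> t" for q
    using a that assms(2) by (auto simp: all_bits_def less_power2_iff_bit)
  show "z = mask N \<or> z = flip_bit t (mask N)"
  proof (cases "bit z t")
    case True
    have "z = mask N" by (rule bit_eqI) (metis True b assms(1) bit_mask_nat)
    then show ?thesis ..
  next
    case False
    have "z = flip_bit t (mask N)"
      by (rule bit_eqI) (use False b assms(1) in \<open>auto simp: bit_mask_nat bit_flip_bit_nat\<close>)
    then show ?thesis ..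
  qed
next
  assume "z = mask N \<or> z = flip_bit t (mask N)"
  then show "all_bits ({..<N} - {t}) z"
    by (auto simp: all_bits_def bit_mask_nat bit_flip_bit_nat split: if_splits)
qed

lemma ctrl_full_lev2:
  assumes "t < N" "supp N f"
  shows "ctrl t (all_bits ({..<N} - {t})) M f = lev2 (flip_bit t (mask N)) (mask N) M f"
proof
  fix z
  obtain a b c d where M: "M = (a, b, c, d)" by (metis prod.exhaust)
  show "ctrl t (all_bits ({..<N} - {t})) M f z = lev2 (flip_bit t (mask N)) (mask N) M f z"
  proof (cases "z < 2 ^ N")
    case True
    then show ?thesis using assms(1)
      by (auto simp: ctrl_def loc_def all_bits_full_iff M bit_mask_nat bit_flip_bit_nat)
  next
    case False
    then have "f z = 0" "f (flip_bit t z) = 0" using assms by (auto simp: supp_def not_less)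
    moreover have "z \<noteq> mask N" "z \<noteq> flip_bit t (mask N)"
      using False mask_less[of N] flip_bit_less_iff[OF assms(1), of "mask N"] by metis+
    ultimately show ?thesis by (simp add: ctrl_def loc_def M)
  qed
qed

lemma lev2_conj:
  assumes "\<And>z. \<sigma> (\<sigma> z) = z"
  shows "lev2 x y M (f \<circ> \<sigma>) \<circ> \<sigma> = lev2 (\<sigma> x) (\<sigma> y) M f"
proof -
  have "\<sigma> z = x \<longleftrightarrow> z = \<sigma> x" for z x using assms by metis
  then show ?thesis by (cases M) (auto simp: fun_eq_iff assms)
qed

lemma circuit_op_on_lev2_conj:
  assumes "\<And>z. \<sigma> (\<sigma> z) = z" "circuit_op N (\<lambda>f. f \<circ> \<sigma>)" "circuit_op_on N (lev2 (\<sigma> x) (\<sigma> y) M)"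
  shows "circuit_op_on N (lev2 x y M)"
proof -
  have "circuit_op_on N (\<lambda>f. lev2 (\<sigma> x) (\<sigma> y) M (f \<circ> \<sigma>) \<circ> \<sigma>)"
    using circuit_op_on_comp[OF circuit_op_circuit_op_on[OF assms(2)] circuit_op_on_comp[OF assms(3) circuit_op_circuit_op_on[OF assms(2)]]] .
  then show ?thesis by (simp add: lev2_conj assms(1))
qed

lemma ctrl_X_perm: "ctrl t P m2_X = (\<lambda>f. f \<circ> (\<lambda>z. if P z then flip_bit t z else z))"
  by (simp add: fun_eq_iff ctrl_def loc_def)

lemma circuit_op_perm_flip: "p < N \<Longrightarrow> circuit_op N (\<lambda>f. f \<circ> flip_bit p)"
  using circuit_op_X[of p N] by (simp add: ctrl_X_perm)

lemma circuit_op_perm_ctrl: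
  assumes "c < N" "t < N" "c \<noteq> t"
  shows "circuit_op N (\<lambda>f. f \<circ> (\<lambda>z. if bit z c = v then flip_bit t z else z))"
proof (cases v)
  case True
  then show ?thesis using circuit_op_CX[OF assms] by (simp add: ctrl_X_perm)
next
  case False
  have "(\<lambda>z::nat. if bit z c = v then flip_bit t z else z) = (\<lambda>z. if bit z c then flip_bit t z else z) \<circ> flip_bit t"
    using False assms(3) by (auto simp: fun_eq_iff bit_flip_bit_nat)
  then show ?thesis
    using circuit_op_comp[OF circuit_op_perm_flip[OF assms(2)] circuit_op_CX[OF assms, unfolded ctrl_X_perm]]
    by (simp add: o_assoc)
qed

text \<open>X and CX gates relabel the levels until the pair is the standard one. Each step flips
  only one bit \<open>q\<close> other than \<open>t\<close>, so \<open>t\<close> keeps separating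
  \<open>x\<close> from \<open>y\<close>, and it lowers the number of bits, apart from
  \<open>t\<close>, that are not set in both.\<close>

lemma circuit_op_on_lev2_oriented:
  assumes full: "\<And>t. t < N \<Longrightarrow> circuit_op_on N (lev2 (flip_bit t (mask N)) (mask N) M)"
    and "t < N" "x < 2 ^ N" "y < 2 ^ N" "\<not> bit x t" "bit y t"
  shows "circuit_op_on N (lev2 x y M)"
  using assms(3-)
proof (induction "card {q. q < N \<and> q \<noteq> t \<and> \<not> (bit x q \<and> bit y q)}" arbitrary: x y rule: less_induct)
  case less
  let ?bad = "\<lambda>x y. {q. q < N \<and> q \<noteq> t \<and> \<not> (bit x q \<and> bit y q)}"
  show ?case
  proof (cases "?bad x y = {}")
    case True
    then have one: "bit x q \<and> bit y q" if "q < N" "q \<noteq> t" for q using that by blast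
    have out: "\<not> bit x q \<and> \<not> bit y q" if "\<not> q < N" for q
      using less.prems(1,2) that by (simp add: less_power2_iff_bit)
    have "y = mask N"
      by (rule bit_eqI) (metis bit_mask_nat one out less.prems(4))
    moreover have "x = flip_bit t (mask N)"
      by (rule bit_eqI) (metis bit_mask_nat bit_flip_bit_nat one out less.prems(3) assms(2))
    ultimately show ?thesis using full[OF assms(2)] by simp
  next
    case False
    then obtain q where q: "q < N" "q \<noteq> t" "\<not> (bit x q \<and> bit y q)" by blast
    have step: "circuit_op_on N (lev2 x y M)"
      if inv: "\<And>z. \<sigma> (\<sigma> z) = z" and im: "circuit_op N (\<lambda>f. f \<circ> \<sigma>)"
        and lt: "\<And>z. z < 2 ^ N \<Longrightarrow> \<sigma> z < 2 ^ N"
        and same: "\<And>z r. r \<noteq> q \<Longrightarrow> bit (\<sigma> z) r = bit z r"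
        and good: "bit (\<sigma> x) q" "bit (\<sigma> y) q" for \<sigma>
    proof (rule circuit_op_on_lev2_conj[OF inv im], rule less.hyps)
      have "?bad (\<sigma> x) (\<sigma> y) \<subset> ?bad x y"
      proof
        show "?bad (\<sigma> x) (\<sigma> y) \<subseteq> ?bad x y" using same good by (smt (verit) Collect_mono)
        show "?bad (\<sigma> x) (\<sigma> y) \<noteq> ?bad x y" using q good by blast
      qed
      then show "card (?bad (\<sigma> x) (\<sigma> y)) < card (?bad x y)" by (intro psubset_card_mono) auto
    qed (use less.prems lt same q in auto)
    show ?thesis
    proof (cases "bit x q = bit y q")
      case True
      show ?thesis
        by (rule step[of "flip_bit q"]) (use True q in \<open>auto simp: circuit_op_perm_flip bit_flip_bit_nat\<close>)
    next
      case False
      \<comment> \<open>Bit \<open>t\<close> is clear in \<open>x\<close> and set in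
        \<open>y\<close>, so the condition singles out whichever of the two lacks bit
        \<open>q\<close>.\<close>
      show ?thesis
        by (rule step[of "\<lambda>z. if bit z t = bit x q then flip_bit q z else z"])
           (use False q less.prems assms(2) in \<open>auto simp: circuit_op_perm_ctrl bit_flip_bit_nat\<close>)
    qed
  qed
qed

lemma circuit_op_on_lev2_full:
  assumes full: "\<And>t. t < N \<Longrightarrow> circuit_op_on N (lev2 (flip_bit t (mask N)) (mask N) M)"
    and "x < 2 ^ N" "y < 2 ^ N" "x \<noteq> y"
  shows "circuit_op_on N (lev2 x y M)"
proof -
  obtain t where t: "bit x t \<noteq> bit y t" using assms(4) by (metis bit_eqI)
  then have tN: "t < N" using assms(2,3) by (metis less_power2_iff_bit not_less)
  show ?thesis
  proof (cases "bit x t")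
    case False
    then show ?thesis using circuit_op_on_lev2_oriented[OF full tN] t assms by blast
  next
    case True
    then have "circuit_op_on N (lev2 (flip_bit t x) (flip_bit t y) M)"
      by (intro circuit_op_on_lev2_oriented[OF full tN]) (use t tN assms in \<open>auto simp: bit_flip_bit_nat\<close>)
    then show ?thesis by (rule circuit_op_on_lev2_conj[OF flip_flip_bit circuit_op_perm_flip[OF tN]])
  qed
qed

lemma circuit_op_on_lev2_D_nH:
  assumes "N \<ge> 2" "x < 2 ^ N" "y < 2 ^ N" "x \<noteq> y"
  shows "circuit_op_on N (lev2 x y m2_D)" "circuit_op_on N (lev2 x y m2_nH)"
proof -
  have "circuit_op_on N (lev2 (flip_bit t (mask N)) (mask N) m2_D)" if "t < N" for t
    by (rule circuit_op_on_cong[OF _ circuit_op_circuit_op_on[OF circuit_op_full_D[OF assms(1) that]]]) (rule ctrl_full_lev2[OF that])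
  then show "circuit_op_on N (lev2 x y m2_D)" by (rule circuit_op_on_lev2_full) (use assms in auto)
  have "circuit_op_on N (lev2 (flip_bit t (mask N)) (mask N) m2_nH)" if "t < N" for t
    by (rule circuit_op_on_cong[OF _ circuit_op_circuit_op_on[OF circuit_op_full_nH[OF assms(1) that]]]) (rule ctrl_full_lev2[OF that])
  then show "circuit_op_on N (lev2 x y m2_nH)" by (rule circuit_op_on_lev2_full) (use assms in auto)
qed

lemma circuit_op_on_lev2_D_power:
  assumes "N \<ge> 2" "x < 2 ^ N" "y < 2 ^ N" "x \<noteq> y"
  shows "circuit_op_on N (lev2 x y (m2_diag (cnj \<omega> ^ k) (\<omega> ^ k)))"
proof (induction k)
  case 0
  show ?case by (rule circuit_op_on_cong[OF _ circuit_op_circuit_op_on[OF circuit_op_id]]) simp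
next
  case (Suc k)
  then show ?case using circuit_op_on_lev2_mult[OF assms(4) circuit_op_on_lev2_D_nH(1)[OF assms] Suc] by (simp del: lev2.simps)
qed

definition phase_at :: "nat \<Rightarrow> nat \<Rightarrow> amp \<Rightarrow> amp" where
  "phase_at x k f = f(x := \<omega> ^ k * f x)"

text \<open>Words in the generators, extended on the left. The set \<open>A\<close> bounds the
  levels that are touched, so that columns supported elsewhere stay fixed.\<close>

inductive_set level_ops :: "nat set \<Rightarrow> (amp \<Rightarrow> amp) set" for A where
  id: "(\<lambda>f. f) \<in> level_ops A"
| phase: "x \<in> A \<Longrightarrow> F \<in> level_ops A \<Longrightarrow> (\<lambda>f. phase_at x 1 (F f)) \<in> level_ops A"
| nH: "x \<in> A \<Longrightarrow> y \<in> A \<Longrightarrow> x \<noteq> y \<Longrightarrow> F \<in> level_ops A \<Longrightarrow> (\<lambda>f. lev2 x y m2_nH (F f)) \<in> level_ops A"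

lemma omega_cnj_power [simp]: "\<omega> ^ k * cnj \<omega> ^ k = 1" "cnj \<omega> ^ k * \<omega> ^ k = 1"
  by (simp_all flip: power_mult_distrib)

lemma omega_cnj_power_left [simp]: "\<omega> ^ k * (cnj \<omega> ^ k * u) = u" "cnj \<omega> ^ k * (\<omega> ^ k * u) = u"
  by (simp_all flip: mult.assoc)

text \<open>All phases can be dumped on the last level: the determinant is the only obstruction.\<close>
lemma level_ops_circuit:
  assumes "N \<ge> 2" "F \<in> level_ops {..<2 ^ N}"
  shows "\<exists>k G. circuit_op_on N G \<and> (\<forall>f. supp N f \<longrightarrow> F f = phase_at (mask N) k (G f))"
  using assms(2)
proof induction
  case id
  show ?case by (rule exI[of _ 0], rule exI[of _ "\<lambda>f. f"]) (simp add: circuit_op_circuit_op_on[OF circuit_op_id] phase_at_def)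
next
  case (phase x F)
  then obtain k G where G: "circuit_op_on N G" "\<And>f. supp N f \<Longrightarrow> F f = phase_at (mask N) k (G f)" by blast
  show ?case
  proof (cases "x = mask N")
    case True
    then show ?thesis using G
      by (intro exI[of _ "Suc k"] exI[of _ G]) (auto simp: phase_at_def)
  next
    case False
    have "circuit_op_on N (\<lambda>f. lev2 (mask N) x m2_D (G f))"
      by (rule circuit_op_on_comp[OF circuit_op_on_lev2_D_nH(1)[OF assms(1)] G(1)]) (use phase False mask_less in auto)
    moreover have "phase_at x 1 (phase_at (mask N) k g) = phase_at (mask N) (Suc k) (lev2 (mask N) x m2_D g)" for g
      using False by (auto simp: phase_at_def fun_eq_iff simp flip: mult.assoc)
    ultimately show ?thesis using G(2) by (intro exI[of _ "Suc k"]) auto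
  qed
next
  case (nH x y F)
  then obtain k G where G: "circuit_op_on N G" "\<And>f. supp N f \<Longrightarrow> F f = phase_at (mask N) k (G f)" by blast
  let ?L = "mask N :: nat"
  \<comment> \<open>Two qubits have four levels, enough for a level \<open>z\<close> off
    \<open>x\<close>, \<open>y\<close> and the last one. The phase is parked on \<open>z\<close>
    while \<open>m2_nH\<close> acts and then taken back, so that it can be moved past
    \<open>m2_nH\<close> even if the last level is \<open>x\<close> or \<open>y\<close>.\<close>
  have "card {x, y, ?L} < 4" by (auto simp: card_insert_if)
  also have "(4::nat) \<le> 2 ^ N" using power_increasing[OF assms(1), of "2::nat"] by simp
  finally have "\<not> {..<2 ^ N} \<subseteq> {x, y, ?L}" using card_mono[of "{x, y, ?L}" "{..<2 ^ N}"] by auto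
  then obtain z where z: "z < 2 ^ N" "z \<noteq> x" "z \<noteq> y" "z \<noteq> ?L" by blast
  let ?\<Theta> = "m2_diag (cnj \<omega> ^ k) (\<omega> ^ k)"
  have "circuit_op_on N (lev2 ?L z ?\<Theta>)" "circuit_op_on N (lev2 z ?L ?\<Theta>)"
    using z mask_less assms(1) by (auto intro!: circuit_op_on_lev2_D_power)
  moreover have "circuit_op_on N (lev2 x y m2_nH)"
    by (rule circuit_op_on_lev2_D_nH[OF assms(1)]) (use nH.hyps in auto)
  ultimately have I: "circuit_op_on N (\<lambda>f. lev2 ?L z ?\<Theta> (lev2 x y m2_nH (lev2 z ?L ?\<Theta> (G f))))"
    using circuit_op_on_comp[OF _ circuit_op_on_comp[OF _ circuit_op_on_comp[OF _ G(1)]]] by blast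
  have E: "lev2 x y m2_nH (phase_at ?L k g) =
      phase_at ?L k (lev2 ?L z ?\<Theta> (lev2 x y m2_nH (lev2 z ?L ?\<Theta> g)))" for g
    using z nH.hyps(3) by (auto simp: phase_at_def fun_eq_iff)
  show ?case
    by (rule exI[of _ k], rule exI, rule conjI[OF I]) (intro allI impI, simp only: G(2) E)
qed

subsection \<open>Column reduction over the ring generated by the eighth roots of unity\<close>

lemma level_ops_comp: "F \<in> level_ops A \<Longrightarrow> G \<in> level_ops A \<Longrightarrow> (\<lambda>f. F (G f)) \<in> level_ops A"
proof (induction rule: level_ops.induct)
  case (phase x F)
  then show ?case using level_ops.phase[OF phase(1), of "\<lambda>f. F (G f)"] by simp
next
  case (nH x y F)
  then show ?case using level_ops.nH[OF nH(1-3), of "\<lambda>f. F (G f)"] by (simp del: lev2.simps)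
qed simp

lemma level_ops_mono: "F \<in> level_ops A \<Longrightarrow> A \<subseteq> B \<Longrightarrow> F \<in> level_ops B"
proof (induction rule: level_ops.induct)
  case id
  show ?case by (rule level_ops.id)
next
  case (phase x F)
  then show ?case by (blast intro: level_ops.phase)
next
  case (nH x y F)
  then show ?case by (blast intro: level_ops.nH)
qed

lemma level_ops_phase: "x \<in> A \<Longrightarrow> phase_at x k \<in> level_ops A"
proof (induction k)
  case 0
  have "phase_at x 0 = (\<lambda>f. f)" by (simp add: phase_at_def fun_eq_iff)
  then show ?case by (simp add: level_ops.id)
next
  case (Suc k)
  have "phase_at x (Suc k) = (\<lambda>f. phase_at x 1 (phase_at x k f))" by (simp add: phase_at_def fun_eq_iff)
  then show ?case using level_ops.phase[OF Suc.prems Suc.IH[OF Suc.prems]] by simp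
qed

lemma level_ops_lev2: "x \<in> A \<Longrightarrow> y \<in> A \<Longrightarrow> x \<noteq> y \<Longrightarrow> lev2 x y m2_nH \<in> level_ops A"
  using level_ops.nH[OF _ _ _ level_ops.id] by blast

lemma level_ops_fix: "F \<in> level_ops A \<Longrightarrow> (\<And>x. x \<in> A \<Longrightarrow> f x = 0) \<Longrightarrow> F f = f"
  by (induction rule: level_ops.induct) (auto simp: phase_at_def fun_eq_iff)

lemma level_ops_outside: "F \<in> level_ops A \<Longrightarrow> z \<notin> A \<Longrightarrow> F f z = f z"
  by (induction rule: level_ops.induct) (auto simp: phase_at_def)

lemma level_ops_ring: "F \<in> level_ops A \<Longrightarrow> (\<And>z. f z \<in> ring_R 8) \<Longrightarrow> F f z \<in> ring_R 8"
proof (induction arbitrary: z rule: level_ops.induct)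
  case (phase x F)
  then show ?case by (auto simp: phase_at_def intro: ring_R.mult ring_R.zeta)
next
  case (nH x y F)
  have c: "- \<i> / rt2 \<in> ring_R 8" "\<i> / rt2 \<in> ring_R 8"
    using ring_R.mult[OF ring_R_8_consts(2,1)] ring_R.neg[OF ring_R.mult[OF ring_R_8_consts(2,1)]] by simp_all
  have "p * F f x + q * F f y \<in> ring_R 8" if "p \<in> ring_R 8" "q \<in> ring_R 8" for p q
    using that nH by (intro ring_R.add ring_R.mult) auto
  from this[OF c(1) c(1)] this[OF c(1) c(2)] nH.IH[OF nH.prems] show ?case
    unfolding lev2.simps fun_upd_apply by (cases "z = x"; cases "z = y") (simp_all only: simp_thms if_True if_False)
qed auto

lemma level_ops_linear:
  "F \<in> level_ops A \<Longrightarrow> F (\<lambda>x. \<Sum>j\<in>J. c j * h j x) = (\<lambda>x. \<Sum>j\<in>J. c j * F (h j) x)"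
proof (induction rule: level_ops.induct)
  case (phase x F)
  then show ?case by (auto simp: phase_at_def fun_eq_iff sum_distrib_left mult_ac)
next
  case (nH x y F)
  have "p * (\<Sum>j\<in>J. c j * F (h j) x) + q * (\<Sum>j\<in>J. c j * F (h j) y) =
      (\<Sum>j\<in>J. c j * (p * F (h j) x + q * F (h j) y))" for p q
    by (simp add: sum_distrib_left sum.distrib algebra_simps)
  then have "lev2 x y m2_nH (\<lambda>x. \<Sum>j\<in>J. c j * F (h j) x) z = (\<Sum>j\<in>J. c j * lev2 x y m2_nH (F (h j)) z)" for z
    by (cases "z = x"; cases "z = y") (simp_all only: lev2.simps fun_upd_apply simp_thms if_True if_False)
  then show ?case unfolding nH.IH by blast
qed simp

lemma m2_unitary_nH: "m2_unitary m2_nH"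
  using rt2_squared by (simp add: field_simps)

lemma lev2_ip:
  assumes "finite B" "x \<in> B" "y \<in> B" "x \<noteq> y" "m2_unitary M"
  shows "(\<Sum>z\<in>B. cnj (lev2 x y M f z) * lev2 x y M g z) = (\<Sum>z\<in>B. cnj (f z) * g z)"
proof -
  obtain a b c d where M: "M = (a, b, c, d)" by (metis prod.exhaust)
  have split: "(\<Sum>z\<in>B. h z) = h x + h y + (\<Sum>z\<in>B - {x, y}. h z)" for h :: amp
  proof -
    have "(\<Sum>z\<in>B. h z) = (\<Sum>z\<in>{x, y}. h z) + (\<Sum>z\<in>B - {x, y}. h z)"
      using assms by (intro sum.subset_diff[of "{x, y}" B, THEN trans]) (auto simp: add.commute)
    then show ?thesis using assms(4) by simp
  qed
  have "(\<Sum>z\<in>B - {x, y}. cnj (lev2 x y M f z) * lev2 x y M g z) = (\<Sum>z\<in>B - {x, y}. cnj (f z) * g z)"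
    by (rule sum.cong) (auto simp: M)
  then show ?thesis
    unfolding split using m2_unitary_ip[OF assms(5)[unfolded M], of "f x" "f y" "g x" "g y"] assms(4)
    by (simp add: M)
qed

lemma level_ops_ip:
  "F \<in> level_ops A \<Longrightarrow> finite B \<Longrightarrow> A \<subseteq> B \<Longrightarrow>
    (\<Sum>z\<in>B. cnj (F f z) * F g z) = (\<Sum>z\<in>B. cnj (f z) * g z)"
proof (induction rule: level_ops.induct)
  case (phase x F)
  have "(\<Sum>z\<in>B. cnj (phase_at x 1 (F f) z) * phase_at x 1 (F g) z) = (\<Sum>z\<in>B. cnj (F f z) * F g z)"
    by (rule sum.cong) (auto simp: phase_at_def mult_ac)
  then show ?case using phase by simp
next
  case (nH x y F)
  then show ?case using lev2_ip[OF _ _ _ _ m2_unitary_nH, of B x y "F f" "F g"]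
    by (auto simp del: lev2.simps m2_unitary.simps)
qed simp

definition basis :: "nat \<Rightarrow> amp" where
  "basis x z = (if z = x then 1 else 0)"

text \<open>Negating the second row of \<open>m2_nH\<close> gives \<i> times the rotation by 135
  degrees. Its square is the rotation by 90 degrees, which carries the first basis vector to the
  second.\<close>

lemma level_ops_move_basis:
  assumes "x \<in> A" "y \<in> A"
  shows "\<exists>F\<in>level_ops A. F (basis x) = basis y"
proof (cases "x = y")
  case True
  show ?thesis by (rule bexI[OF _ level_ops.id]) (simp add: True)
next
  case False
  define c where "c = \<i> / rt2"
  have c: "m2_nH = (- c, - c, - c, c)" "c * c = - 1 / 2"
    using rt2_squared by (simp_all add: c_def field_simps)
  define G where "G = (\<lambda>f. phase_at y 4 (lev2 x y m2_nH f))"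
  have G: "G \<in> level_ops A"
    unfolding G_def by (rule level_ops_comp[OF level_ops_phase[OF assms(2)] level_ops_lev2[OF assms False]])
  have Gf: "G f z = (if z = y then c * f x - c * f y else if z = x then - c * f x - c * f y else f z)" for f z
    unfolding G_def c(1) using False by (simp add: phase_at_def omega_power4)
  have "G (G (basis x)) z = basis y z" for z
    using c(2) False by (simp add: Gf basis_def)
  then have "G (G (basis x)) = basis y" by blast
  then show ?thesis using level_ops_comp[OF G G] by (rule bexI)
qed

section \<open>Divisibility by \<open>1 + \<omega>\<close> and reduction of a single column\<close>

lemma val_rot: "\<omega> * val (a, b, c, d) = val (- d, a, b, c)"
  using omega_power4 by (simp add: algebra_simps power2_eq_square power3_eq_cube power4_eq_xxxx)

lemma val_diff: "val (a, b, c, d) - val (a', b', c', d') = val (a - a', b - b', c - c', d - d')"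
  by (simp add: algebra_simps)

lemma quad_even_div:
  assumes "\<not> quad_odd t"
  shows "\<exists>t'. val t = (1 + \<omega>) * val t'"
proof -
  obtain a b c d where t: "t = (a, b, c, d)" by (metis prod.exhaust)
  have "even (a + b - c + d)" using assms t by simp
  \<comment> \<open>Comparing coordinates in
    \<open>(1 + \<omega>) * val (p, q, r, s) = val t\<close> forces
    \<open>2 p = a + b - c + d\<close> and then determines \<open>q\<close>, \<open>r\<close> and
    \<open>s\<close>.\<close>
  then obtain p where p: "a + b - c + d = 2 * p" by (elim evenE)
  have "(1 + \<omega>) * val (p, b - p, c - b + p, d - c + b - p) =
    val (p, b - p, c - b + p, d - c + b - p) + val (- (d - c + b - p), p, b - p, c - b + p)"
    unfolding val_rot[symmetric] by (simp add: distrib_right del: val.simps)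
  also have "\<dots> = val t"
  proof -
    have "p + - (d - c + b - p) = a" using p by linarith
    then show ?thesis unfolding val_add t by (simp del: val.simps)
  qed
  finally show ?thesis by metis
qed

text \<open>Coordinates of equal parity: the ideal generated by
  \<open>sqrt 2 (1 + \<omega>)\<close>, which has index 8.\<close>

fun quad_uniform :: "quad \<Rightarrow> bool" where
  "quad_uniform (a, b, c, d) \<longleftrightarrow> even (b - a) \<and> even (c - b) \<and> even (d - c)"

lemma quad_uniform_div:
  assumes "quad_uniform t"
  shows "\<exists>u. \<not> quad_odd u \<and> - \<i> / rt2 * val t = val u"
proof -
  obtain a b c d where t: "t = (a, b, c, d)" by (metis prod.exhaust)
  have "even (b - a)" "even (c - b)" "even (d - c)" using assms unfolding t quad_uniform.simps by blast+
  then obtain i j k where ijk: "b - a = 2 * i" "c - b = 2 * j" "d - c = 2 * k" unfolding dvd_def by blast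
  then have bcd: "b = a + 2 * i" "c = a + 2 * i + 2 * j" "d = a + 2 * i + 2 * j + 2 * k" by linarith+
  \<comment> \<open>As \<open>- \<i> / rt2\<close> is
    \<open>- (\<omega> + \<omega> ^ 3) / 2\<close>, the new coordinates are
    \<open>(b + d) / 2\<close>, \<open>(c - a) / 2\<close>, \<open>(d - b) / 2\<close> and
    \<open>- (a + c) / 2\<close>.\<close>
  have "- \<i> / rt2 * val t = val (a + 2 * i + j + k, i + j, j + k, - (a + i + j))"
    unfolding t bcd val_Complex by (simp add: complex_eq_iff field_simps)
  then show ?thesis by (intro exI[of _ "(a + 2 * i + j + k, i + j, j + k, - (a + i + j))"]) simp
qed

text \<open>Modulo \<open>\<surd>2 (1 + \<omega>)\<close> every odd element is a power of \<open>\<omega>\<close>, so a suitable phase makes any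
  two odd entries congruent.\<close>
lemma odd_pair_reduce:
  assumes "quad_odd s" "quad_odd t"
  obtains k s' t' where "\<not> quad_odd s'" "\<not> quad_odd t'"
    "- \<i> / rt2 * val s + - \<i> / rt2 * (\<omega> ^ k * val t) = val s'"
    "- \<i> / rt2 * val s + \<i> / rt2 * (\<omega> ^ k * val t) = val t'"
proof -
  obtain a b c d where s: "s = (a, b, c, d)" by (metis prod.exhaust)
  obtain a' b' c' d' where t: "t = (a', b', c', d')" by (metis prod.exhaust)
  have r: "\<omega> ^ 0 * val t = val (a', b', c', d')" "\<omega> ^ 1 * val t = val (- d', a', b', c')"
    "\<omega> ^ 2 * val t = val (- c', - d', a', b')" "\<omega> ^ 3 * val t = val (- b', - c', - d', a')"
    unfolding t by (simp_all add: power2_eq_square power3_eq_cube mult.assoc val_rot del: val.simps)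
  \<comment> \<open>Up to complementing all four parities, an odd quadruple has exactly one odd
    coordinate, and multiplication by \<omega> shifts it cyclically. Signs do not affect parity, so
    four shifts suffice.\<close>
  have "quad_uniform (a + a', b + b', c + c', d + d') \<or> quad_uniform (a + - d', b + a', c + b', d + c') \<or>
    quad_uniform (a + - c', b + - d', c + a', d + b') \<or> quad_uniform (a + - b', b + - c', c + - d', d + a')"
    using assms unfolding s t quad_odd.simps quad_uniform.simps
    by (cases "even a"; cases "even b"; cases "even c"; cases "even d";
        cases "even a'"; cases "even b'"; cases "even c'"; cases "even d'") simp_all
  then obtain k p q u v where k: "\<omega> ^ k * val t = val (p, q, u, v)"
    and e: "quad_uniform (a + p, b + q, c + u, d + v)"
    using r by metis
  have e': "quad_uniform (a - p, b - q, c - u, d - v)" using e by simp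
  obtain s' where s': "\<not> quad_odd s'" "- \<i> / rt2 * val (a + p, b + q, c + u, d + v) = val s'"
    using quad_uniform_div[OF e] by blast
  obtain t' where t': "\<not> quad_odd t'" "- \<i> / rt2 * val (a - p, b - q, c - u, d - v) = val t'"
    using quad_uniform_div[OF e'] by blast
  show ?thesis
  proof (rule that[OF s'(1) t'(1)])
    show "- \<i> / rt2 * val s + - \<i> / rt2 * (\<omega> ^ k * val t) = val s'"
      unfolding s'(2)[symmetric] k s val_add[symmetric] by (simp add: distrib_left del: val.simps)
    show "- \<i> / rt2 * val s + \<i> / rt2 * (\<omega> ^ k * val t) = val t'"
      unfolding t'(2)[symmetric] k s val_diff[symmetric] by (simp add: right_diff_distrib del: val.simps)
  qed
qed

lemma val_norm: "cnj (val t) * val t = complex_of_real (of_int (quad_sq t) + of_int (quad_cross t) * sqrt 2)"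
  by (cases t) (simp add: val_Complex complex_eq_iff field_simps power2_eq_square del: val.simps)

lemma one_plus_omega_norm: "cnj (1 + \<omega>) * (1 + \<omega>) = complex_of_real (2 + sqrt 2)"
  by (simp add: omega_Complex complex_eq_iff field_simps)

text \<open>\<open>2 + sqrt 2\<close> is the squared absolute value of \<open>1 + \<omega>\<close>.
  The parity of the rational part of its powers is what later forces odd entries to come in
  pairs.\<close>

lemma norm_power_coords:
  "\<exists>p q :: int. (2 + sqrt 2) ^ k = of_int p + of_int q * sqrt 2 \<and> (if k = 0 then p = 1 else even p)"
proof (induction k)
  case 0
  show ?case by (intro exI[of _ 1] exI[of _ 0]) simp
next
  case (Suc k)
  then obtain p q :: int where "(2 + sqrt 2) ^ k = of_int p + of_int q * sqrt 2" by blast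
  then have "(2 + sqrt 2) ^ Suc k = of_int (2 * p + 2 * q) + of_int (p + 2 * q) * sqrt 2"
    by (simp add: algebra_simps)
  then show ?case by (intro exI[of _ "2 * p + 2 * q"] exI[of _ "p + 2 * q"]) simp
qed

text \<open>Comparison of the parts free of \<open>sqrt 2\<close> turns the norm condition into a
  statement about a sum of nonnegative integers.\<close>

lemma column_sq_sum:
  assumes "(\<Sum>x\<in>A. cnj (val (w x)) * val (w x)) = (cnj (1 + \<omega>) * (1 + \<omega>)) ^ k"
  shows "if k = 0 then (\<Sum>x\<in>A. quad_sq (w x)) = 1 else even (\<Sum>x\<in>A. quad_sq (w x))"
proof -
  obtain p q :: int where pq: "(2 + sqrt 2) ^ k = of_int p + of_int q * sqrt 2" "if k = 0 then p = 1 else even p"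
    using norm_power_coords by blast
  have "complex_of_real (\<Sum>x\<in>A. of_int (quad_sq (w x)) + of_int (quad_cross (w x)) * sqrt 2) =
      complex_of_real (of_int p + of_int q * sqrt 2)"
    using assms unfolding val_norm one_plus_omega_norm of_real_power[symmetric] pq(1) by simp
  then have "(\<Sum>x\<in>A. of_int (quad_sq (w x)) + of_int (quad_cross (w x)) * sqrt 2) = of_int p + of_int q * sqrt 2"
    unfolding of_real_eq_iff .
  then have "of_int ((\<Sum>x\<in>A. quad_sq (w x)) - p) + of_int ((\<Sum>x\<in>A. quad_cross (w x)) - q) * sqrt 2 = 0"
    by (simp add: sum.distrib sum_distrib_right left_diff_distrib)
  from sqrt2_independent_int(1)[OF this] show ?thesis using pq(2) by simp
qed

lemma quad_sq_nonneg: "quad_sq t \<ge> 0"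
  by (cases t) simp

lemma quad_sq_eq_0: "quad_sq t = 0 \<Longrightarrow> t = (0, 0, 0, 0)"
  by (cases t) (simp add: add_nonneg_eq_0_iff)

lemma odd_quad_sq: "odd (quad_sq t) \<longleftrightarrow> quad_odd t"
  by (cases t) simp

lemma quad_sq_eq_1:
  assumes "quad_sq t = 1"
  shows "\<exists>k. val t = \<omega> ^ k"
proof -
  obtain a b c d where t: "t = (a, b, c, d)" by (metis prod.exhaust)
  have sq: "a\<^sup>2 + b\<^sup>2 + c\<^sup>2 + d\<^sup>2 = 1" using assms t by simp
  have small: "x = -1 \<or> x = 0 \<or> x = 1" if "x\<^sup>2 \<le> 1" for x :: int
    using that abs_le_square_iff[of x 1] by auto
  have "a\<^sup>2 \<le> 1" "b\<^sup>2 \<le> 1" "c\<^sup>2 \<le> 1" "d\<^sup>2 \<le> 1"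
    using sq zero_le_power2[of a] zero_le_power2[of b] zero_le_power2[of c] zero_le_power2[of d] by linarith+
  then have "a = -1 \<or> a = 0 \<or> a = 1" "b = -1 \<or> b = 0 \<or> b = 1" "c = -1 \<or> c = 0 \<or> c = 1" "d = -1 \<or> d = 0 \<or> d = 1"
    using small by blast+
  then have "t \<in> {(1,0,0,0), (0,1,0,0), (0,0,1,0), (0,0,0,1), (-1,0,0,0), (0,-1,0,0), (0,0,-1,0), (0,0,0,-1)}"
    using sq unfolding t by (elim disjE) simp_all
  moreover have "\<omega> ^ (4 + k) = - (\<omega> ^ k)" for k by (simp add: power_add omega_power4)
  from this[of 0] this[of 1] this[of 2] this[of 3]
  have "\<omega> ^ 4 = - 1" "\<omega> ^ 5 = - \<omega>" "\<omega> ^ 6 = - (\<omega>\<^sup>2)" "\<omega> ^ 7 = - (\<omega> ^ 3)" by simp_all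
  ultimately have "val t \<in> {\<omega> ^ 0, \<omega> ^ 1, \<omega> ^ 2, \<omega> ^ 3, \<omega> ^ 4, \<omega> ^ 5, \<omega> ^ 6, \<omega> ^ 7}"
    by (elim insertE emptyE) simp_all
  then show ?thesis by blast
qed

lemma one_plus_omega_nz: "1 + \<omega> \<noteq> 0"
proof
  assume "1 + \<omega> = 0"
  then have "Re (1 + \<omega>) = 0" by simp
  then have "1 + 1 / sqrt 2 = 0" by (simp add: omega_Complex)
  moreover have "1 + 1 / sqrt 2 > 0" by (simp add: add_pos_pos)
  ultimately show False by simp
qed

lemma one_plus_cnj_omega_nz: "1 + cnj \<omega> \<noteq> 0"
  using one_plus_omega_nz by (metis complex_cnj_add complex_cnj_cnj complex_cnj_one complex_cnj_zero)

lemma column_base: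
  assumes A: "finite A" "\<kappa> \<in> A" and sq: "(\<Sum>x\<in>A. quad_sq (w x)) = 1"
    and out: "\<And>x. x \<notin> A \<Longrightarrow> val (w x) = 0"
  shows "\<exists>F\<in>level_ops A. F (\<lambda>x. val (w x)) = basis \<kappa>"
proof -
  have "\<exists>x\<in>A. quad_sq (w x) \<noteq> 0" using sq by (metis sum.neutral zero_neq_one)
  then obtain x where x: "x \<in> A" "quad_sq (w x) \<noteq> 0" by blast
  have s: "quad_sq (w x) + (\<Sum>z\<in>A - {x}. quad_sq (w z)) = 1" using sq sum.remove[OF A(1) x(1), of "\<lambda>x. quad_sq (w x)"] by simp
  have nn: "(\<Sum>z\<in>A - {x}. quad_sq (w z)) \<ge> 0" by (intro sum_nonneg quad_sq_nonneg)
  have "quad_sq (w x) \<ge> 1" using x(2) quad_sq_nonneg[of "w x"] by linarith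
  then have 1: "quad_sq (w x) = 1" and 0: "(\<Sum>z\<in>A - {x}. quad_sq (w z)) = 0" using s nn by linarith+
  have z: "val (w z) = 0" if "z \<noteq> x" for z
  proof (cases "z \<in> A")
    case True
    have "quad_sq (w z) = 0"
      using 0 True that A(1) by (subst (asm) sum_nonneg_eq_0_iff) (auto simp: quad_sq_nonneg)
    then show ?thesis using quad_sq_eq_0[of "w z"] by simp
  qed (simp add: out)
  obtain k where k: "val (w x) = \<omega> ^ k" using quad_sq_eq_1[OF 1] by blast
  \<comment> \<open>\<open>7 k\<close> stands for \<open>-k\<close>, since \<omega> has order
    8.\<close>
  have "phase_at x (7 * k) (\<lambda>x. val (w x)) = basis x"
  proof -
    have "\<omega> ^ (7 * k) * \<omega> ^ k = (\<omega> ^ 8) ^ k" by (simp flip: power_add power_mult)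
    then show ?thesis using z k by (auto simp: phase_at_def basis_def fun_eq_iff omega_power8)
  qed
  moreover obtain F where F: "F \<in> level_ops A" "F (basis x) = basis \<kappa>" using level_ops_move_basis[OF x(1) A(2)] by blast
  ultimately have "F (phase_at x (7 * k) (\<lambda>x. val (w x))) = basis \<kappa>" by simp
  then show ?thesis
    using level_ops_comp[OF F(1) level_ops_phase[OF x(1), of "7 * k"]] by (rule bexI)
qed

lemma scaled_norm_sum:
  "(\<Sum>z\<in>A. cnj (g z / c) * (g z / c)) = (\<Sum>z\<in>A. cnj (g z) * g z) / (cnj c * c)" for g :: amp
  by (simp add: sum_divide_distrib)

text \<open>Outer induction on the exponent, inner induction on the number of odd entries. For a
  positive exponent that number is even, because \<open>quad_sq\<close> has an even sum and is odd
  exactly at the odd entries; so an odd entry always has a partner. When none is left, a factor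
  \<open>1 + \<omega>\<close> cancels.\<close>

lemma column_reduce:
  assumes A: "finite A" "\<kappa> \<in> A"
    and "(\<Sum>x\<in>A. cnj (val (w x)) * val (w x)) = (cnj (1 + \<omega>) * (1 + \<omega>)) ^ k"
    and "\<And>x. x \<notin> A \<Longrightarrow> val (w x) = 0"
  shows "\<exists>F\<in>level_ops A. F (\<lambda>x. val (w x) / (1 + \<omega>) ^ k) = basis \<kappa>"
  using assms(3,4)
proof (induction k arbitrary: w)
  case 0
  have "(\<Sum>x\<in>A. quad_sq (w x)) = 1" using column_sq_sum[OF 0(1)] by simp
  then show ?case using column_base[OF A, of w] 0(2) by (simp del: val.simps)
next
  case (Suc k)
  from Suc.prems show ?case
  proof (induction "card {x \<in> A. quad_odd (w x)}" arbitrary: w rule: less_induct)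
    case less
    let ?c = "(1 + \<omega>) ^ Suc k"
    let ?n = "cnj (1 + \<omega>) * (1 + \<omega>)"
    have n0: "?n \<noteq> 0" using one_plus_omega_nz by (metis complex_cnj_zero_iff mult_eq_0_iff)
    show ?case
    proof (cases "{x \<in> A. quad_odd (w x)} = {}")
      case True
      have "\<exists>t. val (w x) = (1 + \<omega>) * val t" for x
      proof (cases "x \<in> A")
        case True
        then show ?thesis using \<open>{x \<in> A. quad_odd (w x)} = {}\<close> by (intro quad_even_div) blast
      next
        case False
        then show ?thesis using less.prems(2) by (intro exI[of _ "(0, 0, 0, 0)"]) simp
      qed
      then obtain w' where w': "\<And>x. val (w x) = (1 + \<omega>) * val (w' x)" by metis
      have "?n * (\<Sum>x\<in>A. cnj (val (w' x)) * val (w' x)) = (\<Sum>x\<in>A. cnj (val (w x)) * val (w x))"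
        unfolding w' sum_distrib_left by (rule sum.cong) (simp_all add: mult_ac del: val.simps)
      then have "?n * (\<Sum>x\<in>A. cnj (val (w' x)) * val (w' x)) = ?n * ?n ^ k"
        using less.prems(1) by (simp only: power_Suc)
      then have 1: "(\<Sum>x\<in>A. cnj (val (w' x)) * val (w' x)) = ?n ^ k"
        using n0 by (simp only: mult_cancel_left) blast
      have 2: "val (w' x) = 0" if "x \<notin> A" for x
        using less.prems(2)[OF that] w'[of x] one_plus_omega_nz by simp
      have eq: "(\<lambda>x. val (w x) / ?c) = (\<lambda>x. val (w' x) / (1 + \<omega>) ^ k)"
        unfolding w' using one_plus_omega_nz by (simp add: fun_eq_iff del: val.simps)
      show ?thesis unfolding eq by (rule Suc.IH[OF 1 2])
    next
      case False
      have "even (\<Sum>x\<in>A. quad_sq (w x))" using column_sq_sum[OF less.prems(1)] by simp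
      then have ev: "even (card {x \<in> A. quad_odd (w x)})"
        using even_sum_iff[OF A(1), of "\<lambda>x. quad_sq (w x)"] by (simp add: odd_quad_sq)
      obtain x where x: "x \<in> A" "quad_odd (w x)" using False by blast
      have "{x \<in> A. quad_odd (w x)} \<noteq> {x}"
      proof
        assume "{x \<in> A. quad_odd (w x)} = {x}"
        then have "card {x \<in> A. quad_odd (w x)} = 1" by simp
        then show False using ev by simp
      qed
      then obtain y where y: "y \<in> A" "quad_odd (w y)" "x \<noteq> y" using x by blast
      obtain j s t where st: "\<not> quad_odd s" "\<not> quad_odd t"
        and s: "- \<i> / rt2 * val (w x) + - \<i> / rt2 * (\<omega> ^ j * val (w y)) = val s"
        and t: "- \<i> / rt2 * val (w x) + \<i> / rt2 * (\<omega> ^ j * val (w y)) = val t"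
        using odd_pair_reduce[OF x(2) y(2)] by blast
      define w' where "w' = w(x := s, y := t)"
      let ?v = "\<lambda>z. val (w z) / ?c" and ?v' = "\<lambda>z. val (w' z) / ?c"
      define G where "G = (\<lambda>f. lev2 x y m2_nH (phase_at y j f))"
      have G: "G \<in> level_ops A"
        unfolding G_def by (rule level_ops_comp[OF level_ops_lev2[OF x(1) y(1,3)] level_ops_phase[OF y(1)]])
      have Gv: "G ?v = ?v'"
      proof
        fix z
        have sc: "p * (a / ?c) + q * (r * (b / ?c)) = (p * a + q * (r * b)) / ?c" for p q r a b
          by (simp add: add_divide_distrib)
        show "G ?v z = ?v' z"
          using y(3) unfolding G_def lev2.simps phase_at_def w'_def fun_upd_apply
          by (cases "z = x"; cases "z = y") (simp_all only: simp_thms if_True if_False sc s t)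
      qed
      have "(\<Sum>z\<in>A. cnj (?v' z) * ?v' z) = (\<Sum>z\<in>A. cnj (?v z) * ?v z)"
        using level_ops_ip[OF G A(1) subset_refl, of ?v ?v] unfolding Gv .
      then have "(\<Sum>z\<in>A. cnj (val (w' z)) * val (w' z)) = (\<Sum>z\<in>A. cnj (val (w z)) * val (w z))"
        unfolding scaled_norm_sum using one_plus_omega_nz one_plus_cnj_omega_nz by (simp del: val.simps)
      then have norm': "(\<Sum>z\<in>A. cnj (val (w' z)) * val (w' z)) = ?n ^ Suc k"
        using less.prems(1) by (simp only:)
      have out': "val (w' z) = 0" if "z \<notin> A" for z
        using less.prems(2)[OF that] that x y by (auto simp: w'_def simp del: val.simps)
      have "{z \<in> A. quad_odd (w' z)} \<subset> {z \<in> A. quad_odd (w z)}"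
        using st x by (auto simp: w'_def)
      then have "card {z \<in> A. quad_odd (w' z)} < card {z \<in> A. quad_odd (w z)}"
        by (rule psubset_card_mono[rotated]) (simp add: A(1))
      from less.hyps[OF this norm' out'] obtain F where F: "F \<in> level_ops A" "F ?v' = basis \<kappa>" by blast
      have "F (G ?v) = basis \<kappa>" using F(2) Gv by (simp only:)
      then show ?thesis using level_ops_comp[OF F(1) G] by (rule bexI)
    qed
  qed
qed

lemma ring_R_8_column:
  assumes "finite A" "\<And>x. v x \<in> ring_R 8" "\<And>x. x \<notin> A \<Longrightarrow> v x = 0"
  shows "\<exists>k w. \<forall>x. v x = val (w x) / (1 + \<omega>) ^ k"
proof -
  have "\<forall>x. \<exists>k t. v x = val t / 2 ^ k" using ring_R_8_val[OF assms(2)] by blast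
  then obtain k t where kt: "\<And>x. v x = val (t x) / 2 ^ k x" by metis
  define K where "K = (\<Sum>x\<in>A. k x)"
  \<comment> \<open>An algebraic integer, by \<open>\<omega> ^ 4 = -1\<close>. It converts a
    denominator \<open>2 ^ K\<close> into \<open>(1 + \<omega>) ^ (4 * K)\<close>.\<close>
  let ?u = "(1 + \<omega>) ^ 4 / 2"
  have "?u = 2 * \<omega> + 3 * \<omega>\<^sup>2 + 2 * \<omega> ^ 3"
    using omega_power4 by (simp add: algebra_simps power2_eq_square power3_eq_cube power4_eq_xxxx)
  then have u: "?u \<in> range val" by (intro range_eqI[of _ _ "(0, 2, 3, 2)"]) simp
  have "\<exists>s. v x = val s / (1 + \<omega>) ^ (4 * K)" for x
  proof (cases "x \<in> A")
    case True
    then have "k x \<le> K" unfolding K_def using assms(1) by (simp add: member_le_sum)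
    then have "(2::complex) ^ K = 2 ^ k x * 2 ^ (K - k x)" by (simp flip: power_add)
    then have "v x = val (t x) * of_int (2 ^ (K - k x)) / 2 ^ K" unfolding kt by (simp del: val.simps)
    also have "\<dots> = val (t x) * of_int (2 ^ (K - k x)) * ?u ^ K / (1 + \<omega>) ^ (4 * K)"
      using one_plus_omega_nz by (simp add: power_divide power_mult del: val.simps)
    finally show ?thesis
      using range_val_mult[OF range_val_mult[OF rangeI range_val_of_int] range_val_power[OF u]] by (metis imageE)
  next
    case False
    then show ?thesis using assms(3) by (intro exI[of _ "(0, 0, 0, 0)"]) simp
  qed
  then have "\<forall>x. \<exists>s. v x = val s / (1 + \<omega>) ^ (4 * K)" by (rule allI)
  from choice[OF this] show ?thesis by (rule exI)
qed

text \<open>Once the first \<open>k\<close> columns are basis vectors, orthogonality makes the next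
  column vanish on the levels below \<open>k\<close>. It can be reduced on the remaining levels, and
  operators on those fix the finished columns.\<close>

lemma orthonormal_reduce:
  fixes M :: "nat \<Rightarrow> amp"
  assumes ring: "\<And>j z. j < D \<Longrightarrow> M j z \<in> ring_R 8"
    and out: "\<And>j z. j < D \<Longrightarrow> \<not> z < D \<Longrightarrow> M j z = 0"
    and orth: "\<And>i j. i < D \<Longrightarrow> j < D \<Longrightarrow> (\<Sum>z<D. cnj (M i z) * M j z) = (if i = j then 1 else 0)"
  shows "\<exists>F\<in>level_ops {..<D}. \<forall>j<D. F (M j) = basis j"
proof -
  have "k \<le> D \<Longrightarrow> \<exists>F\<in>level_ops {..<D}. \<forall>j<k. F (M j) = basis j" for k
  proof (induction k)
    case 0
    show ?case by (rule bexI[OF _ level_ops.id]) simp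
  next
    case (Suc k)
    then have kD: "k < D" by simp
    obtain F where F: "F \<in> level_ops {..<D}" "\<And>j. j < k \<Longrightarrow> F (M j) = basis j" 
      using Suc.IH[OF less_imp_le[OF kD]] by (elim bexE) simp
    define v where "v = F (M k)"
    have v_ring: "v z \<in> ring_R 8" for z unfolding v_def by (rule level_ops_ring[OF F(1) ring[OF kD]])
    have v_out: "v z = 0" if "z \<notin> {k..<D}" for z
    proof (cases "z < D")
      case False
      then show ?thesis using level_ops_outside[OF F(1), of z] out[OF kD] by (simp add: v_def)
    next
      case True
      then have z: "z < k" using that by simp
      have "v z = (\<Sum>y<D. cnj (basis z y) * v y)"
      proof -
        have "(\<Sum>y<D. cnj (basis z y) * v y) = (\<Sum>y<D. if y = z then v y else 0)"
          by (rule sum.cong) (auto simp: basis_def)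
        then show ?thesis using True by simp
      qed
      also have "\<dots> = (\<Sum>y<D. cnj (F (M z) y) * F (M k) y)" using F(2)[OF z] by (simp add: v_def)
      also have "\<dots> = (\<Sum>y<D. cnj (M z y) * M k y)" by (rule level_ops_ip[OF F(1)]) auto
      also have "\<dots> = 0" using orth[OF True kD] z by simp
      finally show ?thesis .
    qed
    have v_norm: "(\<Sum>z\<in>{k..<D}. cnj (v z) * v z) = 1"
    proof -
      have "(\<Sum>z\<in>{k..<D}. cnj (v z) * v z) = (\<Sum>z<D. cnj (v z) * v z)"
        by (rule sum.mono_neutral_left) (auto simp: v_out)
      also have "\<dots> = (\<Sum>z<D. cnj (M k z) * M k z)" unfolding v_def by (rule level_ops_ip[OF F(1)]) auto
      finally show ?thesis using orth[OF kD kD] by simp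
    qed
    have "\<exists>e w. \<forall>x. v x = val (w x) / (1 + \<omega>) ^ e"
      by (rule ring_R_8_column[OF finite_atLeastLessThan v_ring v_out])
    then obtain e w where "\<forall>x. v x = val (w x) / (1 + \<omega>) ^ e" by (elim exE)
    then have w: "v x = val (w x) / (1 + \<omega>) ^ e" for x by (rule spec)
    have w_norm: "(\<Sum>x\<in>{k..<D}. cnj (val (w x)) * val (w x)) = (cnj (1 + \<omega>) * (1 + \<omega>)) ^ e"
    proof -
      let ?c = "(1 + \<omega>) ^ e"
      have "(\<Sum>x\<in>{k..<D}. cnj (val (w x)) * val (w x)) / (cnj ?c * ?c) = 1"
        using v_norm unfolding w scaled_norm_sum .
      moreover have "cnj ?c * ?c = (cnj (1 + \<omega>) * (1 + \<omega>)) ^ e"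
        by (simp only: power_mult_distrib complex_cnj_power)
      ultimately show ?thesis by (metis divide_eq_1_iff)
    qed
    have w_out: "val (w x) = 0" if "x \<notin> {k..<D}" for x
      using v_out[OF that] one_plus_omega_nz unfolding w by (simp del: val.simps)
    have "\<exists>G\<in>level_ops {k..<D}. G (\<lambda>x. val (w x) / (1 + \<omega>) ^ e) = basis k"
      by (rule column_reduce[OF _ _ w_norm w_out]) (use kD in auto)
    then obtain G where G: "G \<in> level_ops {k..<D}" "G v = basis k" unfolding w[symmetric] by (elim bexE)
    have G': "G \<in> level_ops {..<D}" by (rule level_ops_mono[OF G(1)]) auto
    have "G (F (M j)) = basis j" if "j < Suc k" for j
    proof (cases "j = k")
      case True
      then show ?thesis using G(2) by (simp add: v_def)
    next
      case False
      then have "j < k" using that by simp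
      then show ?thesis using F(2) level_ops_fix[OF G(1), of "basis j"] by (simp add: basis_def)
    qed
    then have "\<forall>j<Suc k. G (F (M j)) = basis j" by (intro allI impI)
    then show ?case using level_ops_comp[OF G' F(1)] by (rule bexI)
  qed
  from this[OF le_refl] show ?thesis .
qed

subsection \<open>Catalytic embedding\<close>

lemma sum_double: "(\<Sum>z<2 * n. h z) = (\<Sum>x<n. h (2 * x) + h (2 * x + 1))" for h :: amp
  by (induction n) (simp_all add: add.assoc)

text \<open>The column of index \<open>2 y + c\<close> of the matrix obtained from \<open>P + \<zeta> Q\<close> by replacing each
  entry \<open>p + \<zeta> q\<close> by the block \<open>p I + q Z\<close>, where \<open>Z = ((0, \<omega>), (1, 0))\<close> is a unitary square
  root of \<open>\<omega> I\<close>.\<close>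
definition embed_col :: "nat \<Rightarrow> (nat \<Rightarrow> nat \<Rightarrow> complex) \<Rightarrow> (nat \<Rightarrow> nat \<Rightarrow> complex) \<Rightarrow> nat \<Rightarrow> amp" where
  "embed_col n P Q j z = (if z < 2 * n then
     (if even j = even z then P (z div 2) (j div 2)
      else if even j then Q (z div 2) (j div 2) else \<omega> * Q (z div 2) (j div 2)) else 0)"

text \<open>The inner product of columns \<open>a\<close> and \<open>b\<close> of
  \<open>P + \<zeta> Q\<close> has the form \<open>s + \<zeta> t\<close>. By independence
  \<open>t = 0\<close> and \<open>s\<close> is 1 or 0 according to whether \<open>a = b\<close>. The
  inner products of the block columns are \<open>s\<close>, \<open>t\<close> or
  \<open>\<omega> t\<close>.\<close>

lemma embed_col_orthonormal:
  assumes P: "\<And>x y. P x y \<in> ring_R 8" and Q: "\<And>x y. Q x y \<in> ring_R 8"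
    and W: "\<And>a b. a < n \<Longrightarrow> b < n \<Longrightarrow>
      (\<Sum>x<n. cnj (P x a + \<zeta> * Q x a) * (P x b + \<zeta> * Q x b)) = (if a = b then 1 else 0)"
    and ij: "i < 2 * n" "j < 2 * n"
  shows "(\<Sum>z<2 * n. cnj (embed_col n P Q i z) * embed_col n P Q j z) = (if i = j then 1 else 0)"
proof -
  define a b where "a = i div 2" and "b = j div 2"
  have ab: "a < n" "b < n" using ij by (auto simp: a_def b_def)
  let ?s = "\<Sum>x<n. cnj (P x a) * P x b + cnj (Q x a) * Q x b"
  let ?t = "\<Sum>x<n. cnj (P x a) * Q x b + cnj \<omega> * cnj (Q x a) * P x b"
  \<comment> \<open>Writes the conjugate as \<zeta> times an element over the eighth roots, so that
    inner products are again split into two coefficients.\<close>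
  have cz: "cnj \<zeta> = \<zeta> * cnj \<omega>"
    unfolding zeta_squared[symmetric] by (simp add: power2_eq_square flip: mult.assoc)
  have summand: "cnj (P x a + \<zeta> * Q x a) * (P x b + \<zeta> * Q x b) =
      (cnj (P x a) * P x b + cnj (Q x a) * Q x b) + \<zeta> * (cnj (P x a) * Q x b + cnj \<omega> * cnj (Q x a) * P x b)" for x
  proof -
    have "cnj (P x a + \<zeta> * Q x a) * (P x b + \<zeta> * Q x b) = cnj (P x a) * P x b + (cnj \<zeta> * \<zeta>) * (cnj (Q x a) * Q x b)
      + (\<zeta> * (cnj (P x a) * Q x b) + cnj \<zeta> * (cnj (Q x a) * P x b))"
      by (simp add: algebra_simps del: cnj_zeta_mult)
    also have "\<dots> = (cnj (P x a) * P x b + cnj (Q x a) * Q x b) + \<zeta> * (cnj (P x a) * Q x b + cnj \<omega> * cnj (Q x a) * P x b)"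
      unfolding cnj_zeta_mult by (simp add: cz algebra_simps)
    finally show ?thesis .
  qed
  have "?s + \<zeta> * ?t = (\<Sum>x<n. cnj (P x a + \<zeta> * Q x a) * (P x b + \<zeta> * Q x b))"
    unfolding summand by (simp only: sum.distrib[of "\<lambda>x. cnj (P x a) * P x b + cnj (Q x a) * Q x b"] sum_distrib_left)
  also have "\<dots> = (if a = b then 1 else 0)" by (rule W[OF ab])
  finally have eq: "(?s - (if a = b then 1 else 0)) + \<zeta> * ?t = 0"
    by (simp only: diff_add_eq right_minus_eq)
  have R: "?s - (if a = b then 1 else 0) \<in> ring_R 8" "?t \<in> ring_R 8"
    using P Q by (auto intro!: ring_R_diff ring_R_sum ring_R.add ring_R.mult cnj_ring_R_8 intro: ring_R.one ring_R.zeta)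
  have s: "?s = (if a = b then 1 else 0)" and t: "?t = 0"
    using ring_R_8_zeta_independent[OF R eq] by auto
  have t': "(\<Sum>x<n. \<omega> * (cnj (P x a) * Q x b) + cnj (Q x a) * P x b) = 0"
  proof -
    have "(\<Sum>x<n. \<omega> * (cnj (P x a) * Q x b) + cnj (Q x a) * P x b) = \<omega> * ?t"
      unfolding sum_distrib_left by (rule sum.cong) (simp_all add: distrib_left flip: mult.assoc)
    then show ?thesis using t by simp
  qed
  have ij_eq: "i = j \<longleftrightarrow> a = b \<and> even i = even j"
    unfolding a_def b_def by (metis even_two_times_div_two odd_two_times_div_two_succ)
  have "(\<Sum>z<2 * n. cnj (embed_col n P Q i z) * embed_col n P Q j z) =
    (\<Sum>x<n. cnj (embed_col n P Q i (2 * x)) * embed_col n P Q j (2 * x) +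
      cnj (embed_col n P Q i (2 * x + 1)) * embed_col n P Q j (2 * x + 1))"
    by (rule sum_double)
  also have "\<dots> = (if even i = even j then ?s else 0)"
  proof (cases "even i")
    case i: True
    show ?thesis
    proof (cases "even j")
      case True
      then show ?thesis using i by (auto intro!: sum.cong simp: embed_col_def a_def b_def)
    next
      case False
      have "(\<Sum>x<n. cnj (embed_col n P Q i (2 * x)) * embed_col n P Q j (2 * x) +
        cnj (embed_col n P Q i (2 * x + 1)) * embed_col n P Q j (2 * x + 1)) =
        (\<Sum>x<n. \<omega> * (cnj (P x a) * Q x b) + cnj (Q x a) * P x b)"
        using i False by (intro sum.cong) (auto simp: embed_col_def a_def b_def)
      then show ?thesis using t' i False by simp
    qed
  next
    case i: False
    show ?thesis
    proof (cases "even j")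
      case True
      have "(\<Sum>x<n. cnj (embed_col n P Q i (2 * x)) * embed_col n P Q j (2 * x) +
        cnj (embed_col n P Q i (2 * x + 1)) * embed_col n P Q j (2 * x + 1)) = ?t"
        using i True by (intro sum.cong) (auto simp: embed_col_def a_def b_def)
      then show ?thesis using t i True by simp
    next
      case False
      have "cnj (\<omega> * p) * (\<omega> * q) = cnj p * q" for p q
        using cnj_omega_mult(1) by (simp add: mult_ac flip: mult.assoc)
      then show ?thesis using i False by (auto intro!: sum.cong simp: embed_col_def a_def b_def)
    qed
  qed
  also have "\<dots> = (if i = j then 1 else 0)" unfolding s ij_eq by simp
  finally show ?thesis .
qed

text \<open>The state \<open>v \<otimes> \<psi>\<close>, where \<open>\<psi> = (1, \<zeta>\<^sup>-\<^sup>1) / \<surd>2\<close> is the eigenvector of \<open>Z\<close> for the eigenvalue \<open>\<zeta>\<close>.\<close>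
definition catalyzed :: "complex vec \<Rightarrow> amp" where
  "catalyzed v z = (if z div 2 < dim_vec v then v $ (z div 2) * ((if even z then 1 else cnj \<zeta>) / rt2) else 0)"

lemma embed_col_catalyzed:
  assumes "v \<in> carrier_vec n" "W \<in> carrier_mat n n"
    and PQ: "\<And>x y. x < n \<Longrightarrow> y < n \<Longrightarrow> W $$ (x, y) = P x y + \<zeta> * Q x y"
  shows "(\<lambda>z. \<Sum>j<2 * n. catalyzed v j * embed_col n P Q j z) = catalyzed (W *\<^sub>v v)"
proof
  fix z
  show "(\<Sum>j<2 * n. catalyzed v j * embed_col n P Q j z) = catalyzed (W *\<^sub>v v) z"
  proof (cases "z < 2 * n")
    case True
    let ?x = "z div 2"
    have x: "?x < n" using True by auto
    have zo: "cnj \<zeta> * \<omega> = \<zeta>"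
      unfolding zeta_squared[symmetric] by (simp add: power2_eq_square flip: mult.assoc)
    let ?e = "(if even z then 1 else cnj \<zeta>) / rt2"
    have "(\<Sum>j<2 * n. catalyzed v j * embed_col n P Q j z) =
      (\<Sum>y<n. catalyzed v (2 * y) * embed_col n P Q (2 * y) z + catalyzed v (2 * y + 1) * embed_col n P Q (2 * y + 1) z)"
      by (rule sum_double)
    also have "\<dots> = (\<Sum>y<n. W $$ (?x, y) * v $ y * ?e)"
    proof (rule sum.cong)
      fix y assume "y \<in> {..<n}"
      then have y: "y < n" by simp
      show "catalyzed v (2 * y) * embed_col n P Q (2 * y) z + catalyzed v (2 * y + 1) * embed_col n P Q (2 * y + 1) z =
        W $$ (?x, y) * v $ y * ?e"
      proof (cases "even z")
        case ez: True
        have "catalyzed v (2 * y) * embed_col n P Q (2 * y) z + catalyzed v (2 * y + 1) * embed_col n P Q (2 * y + 1) z =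
          v $ y * (P ?x y + (cnj \<zeta> * \<omega>) * Q ?x y) / rt2"
          using y True ez assms(1) by (simp add: catalyzed_def embed_col_def algebra_simps add_divide_distrib)
        then show ?thesis unfolding zo PQ[OF x y] using ez by simp
      next
        case ez: False
        have "catalyzed v (2 * y) * embed_col n P Q (2 * y) z + catalyzed v (2 * y + 1) * embed_col n P Q (2 * y + 1) z =
          v $ y * ((cnj \<zeta> * \<zeta>) * Q ?x y + cnj \<zeta> * P ?x y) / rt2"
          using y True ez assms(1) by (simp add: catalyzed_def embed_col_def algebra_simps add_divide_distrib)
        also have "\<dots> = (P ?x y + \<zeta> * Q ?x y) * v $ y * (cnj \<zeta> / rt2)"
          by (simp add: algebra_simps add_divide_distrib del: cnj_zeta_mult)
        finally show ?thesis unfolding PQ[OF x y] using ez by simp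
      qed
    qed simp
    also have "\<dots> = catalyzed (W *\<^sub>v v) z"
      using x assms(1,2) by (simp add: catalyzed_def scalar_prod_def atLeast0LessThan sum_distrib_right sum_divide_distrib)
    finally show ?thesis .
  next
    case False
    then have "\<not> z div 2 < n" by auto
    then show ?thesis using False assms(2) by (simp add: embed_col_def catalyzed_def)
  qed
qed

lemma adjoint_unitary_columns:
  assumes "U \<in> carrier_mat n n" "unitary U" "a < n" "b < n"
  shows "(\<Sum>x<n. cnj (adjoint U $$ (x, a)) * adjoint U $$ (x, b)) = (if a = b then 1 else 0)"
proof -
  have "(U * adjoint U) $$ (a, b) = (1\<^sub>m n :: complex mat) $$ (a, b)"
    using assms(1,2) by (simp add: unitary_def)
  moreover have "(U * adjoint U) $$ (a, b) = (\<Sum>x<n. U $$ (a, x) * adjoint U $$ (x, b))"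
    using assms by (simp add: adjoint_def scalar_prod_def atLeast0LessThan)
  moreover have "\<dots> = (\<Sum>x<n. cnj (adjoint U $$ (x, a)) * adjoint U $$ (x, b))"
    by (rule sum.cong) (use assms in \<open>auto simp: adjoint_def\<close>)
  ultimately show ?thesis using assms by simp
qed

text \<open>The columns reduced are those of the embedded adjoint. An operator taking them to the
  standard basis inverts that matrix, so it acts as the embedding of \<open>U\<close> itself, and
  level operators never have to be inverted.\<close>

lemma catalyzed_level_ops:
  assumes U: "U \<in> carrier_mat n n" "unitary U"
    and R: "\<And>i j. i < n \<Longrightarrow> j < n \<Longrightarrow> U $$ (i, j) \<in> ring_R 16"
  shows "\<exists>F\<in>level_ops {..<2 * n}. \<forall>u\<in>carrier_vec n. F (catalyzed u) = catalyzed (U *\<^sub>v u)"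
proof -
  let ?W = "adjoint U"
  have W: "?W \<in> carrier_mat n n" using U by (simp add: adjoint_def)
  have "\<exists>p q. p \<in> ring_R 8 \<and> q \<in> ring_R 8 \<and> (x < n \<longrightarrow> y < n \<longrightarrow> ?W $$ (x, y) = p + \<zeta> * q)" for x y
  proof (cases "x < n \<and> y < n")
    case True
    then have "?W $$ (x, y) \<in> ring_R 16" using U R by (auto simp: adjoint_def intro: cnj_ring_R_16)
    from ring_R_16_split[OF this] show ?thesis by blast
  next
    case False
    then show ?thesis using ring_R_0 by blast
  qed
  then obtain P Q where PQ: "\<And>x y. P x y \<in> ring_R 8" "\<And>x y. Q x y \<in> ring_R 8"
    "\<And>x y. x < n \<Longrightarrow> y < n \<Longrightarrow> ?W $$ (x, y) = P x y + \<zeta> * Q x y" by metis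
  have "(\<Sum>x<n. cnj (P x a + \<zeta> * Q x a) * (P x b + \<zeta> * Q x b)) = (if a = b then 1 else 0)"
    if "a < n" "b < n" for a b
    using adjoint_unitary_columns[OF U that] that by (simp add: PQ(3))
  note orth = embed_col_orthonormal[OF PQ(1,2) this]
  have ring: "embed_col n P Q j z \<in> ring_R 8" for j z
    using PQ(1,2) by (auto simp: embed_col_def intro: ring_R.mult ring_R.zeta)
  have "\<exists>F\<in>level_ops {..<2 * n}. \<forall>j<2 * n. F (embed_col n P Q j) = basis j"
    by (rule orthonormal_reduce[OF ring _ orth]) (auto simp: embed_col_def)
  then obtain F where F: "F \<in> level_ops {..<2 * n}" "\<And>j. j < 2 * n \<Longrightarrow> F (embed_col n P Q j) = basis j"
    by (elim bexE) simp
  have "F (catalyzed u) = catalyzed (U *\<^sub>v u)" if u: "u \<in> carrier_vec n" for u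
  proof -
    let ?v = "U *\<^sub>v u"
    have v: "?v \<in> carrier_vec n" using U(1) u by simp
    have "?W * U = 1\<^sub>m n" using U by (simp add: unitary_def)
    then have "?W *\<^sub>v ?v = u" using assoc_mult_mat_vec[OF W U(1) u] u by simp
    then have "catalyzed u = (\<lambda>z. \<Sum>j<2 * n. catalyzed ?v j * embed_col n P Q j z)"
      using embed_col_catalyzed[OF v W PQ(3)] by simp
    then have "F (catalyzed u) = (\<lambda>z. \<Sum>j<2 * n. catalyzed ?v j * F (embed_col n P Q j) z)"
      using level_ops_linear[OF F(1)] by (simp only:)
    also have "\<dots> = (\<lambda>z. \<Sum>j<2 * n. if j = z then catalyzed ?v z else 0)"
      by (intro ext sum.cong) (auto simp: F(2) basis_def)
    also have "\<dots> = catalyzed ?v"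
    proof
      fix z
      show "(\<Sum>j<2 * n. if j = z then catalyzed ?v z else 0) = catalyzed ?v z"
        using U(1) by (auto simp: catalyzed_def)
    qed
    finally show ?thesis .
  qed
  then have "\<forall>u\<in>carrier_vec n. F (catalyzed u) = catalyzed (U *\<^sub>v u)" by (intro ballI)
  then show ?thesis using F(1) by (rule bexI)
qed

section \<open>Removing the leftover phase and assembling the circuit\<close>

text \<open>An exchange of two levels has determinant -1; the factor \<i> brings it to 1. It arises
  as X from Z by Hadamard conjugation, each of the three factors carrying
  \<open>-\<i>\<close>.\<close>

lemma circuit_op_on_lev2_iX:
  assumes "N \<ge> 2" "x < 2 ^ N" "y < 2 ^ N" "x \<noteq> y"
  shows "circuit_op_on N (lev2 x y (0, \<i>, \<i>, 0))"
proof -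
  have "cnj \<omega> ^ 2 = - \<i>" using arg_cong[OF omega_squared, of cnj] by simp
  then have D2: "circuit_op_on N (lev2 x y (m2_diag (- \<i>) \<i>))"
    using circuit_op_on_lev2_D_power[OF assms, of 2] unfolding omega_squared by (simp only:)
  note nH = circuit_op_on_lev2_D_nH(2)[OF assms]
  have "m2_nH \<odot> m2_diag (- \<i>) \<i> \<odot> m2_nH = (0, \<i>, \<i>, 0)"
    using rt2_squared by (simp add: field_simps)
  then show ?thesis
    using circuit_op_on_lev2_mult[OF assms(4) circuit_op_on_lev2_mult[OF assms(4) nH D2] nH] by (simp only:)
qed

definition scale_last :: "nat \<Rightarrow> complex vec \<Rightarrow> complex vec" where
  "scale_last l v = vec (dim_vec v) (\<lambda>i. if Suc i = dim_vec v then \<zeta> ^ l * v $ i else v $ i)"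

definition coord :: "complex vec \<Rightarrow> amp" where
  "coord v q = (if q < dim_vec v then v $ q else 0)"

lemma catalyzed_coord:
  "catalyzed v (2 * q) = coord v q * (1 / rt2)" "catalyzed v (Suc (2 * q)) = coord v q * (cnj \<zeta> / rt2)"
  by (simp_all add: catalyzed_def coord_def)

lemma kron0_coord: "kron0 1 v (2 * q) = coord v q" "kron0 1 v (Suc (2 * q)) = 0"
proof -
  have "Suc (2 * q) mod 2 = 1" by presburger
  then show "kron0 1 v (2 * q) = coord v q" "kron0 1 v (Suc (2 * q)) = 0"
    unfolding kron0_def power_one_right by (simp_all add: coord_def)
qed

lemma coord_scale_last:
  "dim_vec v = Suc r \<Longrightarrow> coord (scale_last l v) q = (if q = r then \<zeta> ^ l else 1) * coord v q"
  by (simp add: coord_def scale_last_def)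

lemma amp_eqI:
  assumes "\<And>q. f (2 * q) = g (2 * q)" "\<And>q. f (Suc (2 * q)) = g (Suc (2 * q))"
  shows "f = (g :: amp)"
proof
  fix z
  show "f z = g z" using assms by (cases "even z") (auto elim!: evenE oddE)
qed

lemma loc_0:
  "loc 0 (\<lambda>_. (a, b, c, d)) f (2 * q) = a * f (2 * q) + b * f (Suc (2 * q))"
  "loc 0 (\<lambda>_. (a, b, c, d)) f (Suc (2 * q)) = c * f (2 * q) + d * f (Suc (2 * q))"
  by (simp_all add: loc_def bit_0 flip_bit_0)

lemma last_levels:
  obtains r where "2 ^ m = Suc r" "2 ^ (m + 1) = 2 * Suc r" "mask (m + 1) = Suc (2 * r)"
proof -
  obtain r where r: "2 ^ m = Suc r" by (metis gr0_conv_Suc zero_less_numeral zero_less_power)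
  then have "2 ^ (m + 1) = 2 * Suc r" by simp
  moreover from this have "mask (m + 1) = Suc (2 * r)" by (simp add: mask_eq_exp_minus_1)
  ultimately show ?thesis using that r by blast
qed

text \<open>A phase \<open>\<omega>\<^sup>k\<close> on the last level has determinant \<open>\<omega>\<^sup>k\<close>, which is also the determinant of a power
  of \<open>Z\<close> on the last two levels; the two differ by a two-level operator of determinant 1.\<close>
lemma phase_to_scale_last:
  assumes "m \<ge> 1"
  shows "\<exists>l G. circuit_op_on (m + 1) G \<and> (\<forall>v\<in>carrier_vec (2 ^ m).
    G (phase_at (mask (m + 1)) k (catalyzed v)) = catalyzed (scale_last l v))"
proof -
  obtain r where r: "2 ^ m = Suc r" "2 ^ (m + 1) = 2 * Suc r" "mask (m + 1) = Suc (2 * r)"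
    by (rule last_levels)
  define x y where "x = 2 * r" and "y = Suc (2 * r)"
  have xy: "x < 2 ^ (m + 1)" "y < 2 ^ (m + 1)" "x \<noteq> y" "y \<noteq> x"
    unfolding r(2) by (simp_all add: x_def y_def)
  have N: "m + 1 \<ge> 2" using assms by simp
  \<comment> \<open>Half of the phase is moved from \<open>y\<close> to \<open>x\<close>, so that
    both levels carry \<open>\<omega> ^ i\<close>, a scalar on the block. For odd \<open>k\<close>
    one more factor \<omega> stays on \<open>y\<close>.\<close>
  define i where "i = k div 2"
  let ?D = "m2_diag (cnj \<omega> ^ i) (\<omega> ^ i)"
  note D = circuit_op_on_lev2_D_power[OF N xy(2,1,4), of i]
  have wz: "\<omega> ^ i = \<zeta> ^ (2 * i)" by (simp add: power_mult zeta_squared)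
  show ?thesis
  proof (cases "even k")
    case True
    then have k: "k = i + i" by (auto simp: i_def)
    have "lev2 y x ?D (phase_at y k (catalyzed v)) = catalyzed (scale_last (2 * i) v)"
      if v: "v \<in> carrier_vec (2 ^ m)" for v
    proof (rule amp_eqI)
      have d: "dim_vec v = Suc r" using v r(1) by simp
      show "lev2 y x ?D (phase_at y k (catalyzed v)) (2 * q) = catalyzed (scale_last (2 * i) v) (2 * q)"
        "lev2 y x ?D (phase_at y k (catalyzed v)) (Suc (2 * q)) = catalyzed (scale_last (2 * i) v) (Suc (2 * q))" for q
        unfolding catalyzed_coord coord_scale_last[OF d] wz[symmetric] k
        by (simp_all add: x_def y_def phase_at_def power_add catalyzed_coord double_not_eq_Suc_double Suc_double_not_eq_double)
    qed
    then show ?thesis unfolding r(3) y_def[symmetric]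
      by (intro exI[of _ "2 * i"] exI[of _ "lev2 y x ?D"] conjI D ballI)
  next
    case False
    then have k: "k = Suc (i + i)" by (auto simp: i_def elim: oddE)
    let ?G = "\<lambda>f. lev2 x y (0, \<i>, \<i>, 0) (lev2 y x ?D f)"
    have G: "circuit_op_on (m + 1) ?G" by (rule circuit_op_on_comp[OF circuit_op_on_lev2_iX[OF N xy(1-3)] D])
    \<comment> \<open>Composed with \<open>diag(1, \<omega>)\<close>, the exchange with factor \<i>
      is \<open>\<i> Z\<close>. Its eigenvalue on the catalyst is
      \<open>\<i> \<zeta> = \<zeta> ^ 5\<close>, whence the 5.\<close>
    have z5: "\<zeta> ^ (2 * i + 5) = \<omega> ^ i * (\<i> * \<zeta>)"
    proof -
      have "\<zeta> ^ 5 = (\<zeta>\<^sup>2)\<^sup>2 * \<zeta>" by (simp flip: power_mult power_Suc2)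
      then show ?thesis unfolding power_add wz zeta_squared omega_squared by simp
    qed
    have oz: "\<omega> * cnj \<zeta> = \<zeta>"
      unfolding zeta_squared[symmetric] by (simp add: power2_eq_square mult.assoc)
    have "?G (phase_at y k (catalyzed v)) = catalyzed (scale_last (2 * i + 5) v)"
      if v: "v \<in> carrier_vec (2 ^ m)" for v
    proof -
      have d: "dim_vec v = Suc r" using v r(1) by simp
      have e: "lev2 y x ?D (phase_at y k (catalyzed v)) =
        (catalyzed v)(y := \<omega> ^ i * (\<omega> * catalyzed v y), x := \<omega> ^ i * catalyzed v x)"
        unfolding k using xy by (auto simp: fun_eq_iff phase_at_def power_add mult_ac)
      have ex: "\<i> * (\<omega> ^ i * (\<omega> * catalyzed v y)) = \<zeta> ^ (2 * i + 5) * coord v r * (1 / rt2)"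
      proof -
        have "\<i> * (\<omega> ^ i * (\<omega> * catalyzed v y)) = \<i> * \<omega> ^ i * coord v r * (\<omega> * cnj \<zeta>) / rt2"
          unfolding y_def catalyzed_coord by (simp add: mult_ac)
        then show ?thesis unfolding oz z5 by (simp add: mult_ac)
      qed
      have ey: "\<i> * (\<omega> ^ i * catalyzed v x) = \<zeta> ^ (2 * i + 5) * coord v r * (cnj \<zeta> / rt2)"
      proof -
        have "\<zeta> ^ (2 * i + 5) * coord v r * (cnj \<zeta> / rt2) = \<i> * \<omega> ^ i * coord v r * (\<zeta> * cnj \<zeta>) / rt2"
          unfolding z5 by (simp add: mult_ac del: cnj_zeta_mult)
        also have "\<dots> = \<i> * (\<omega> ^ i * catalyzed v x)"
          unfolding x_def catalyzed_coord cnj_zeta_mult by simp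
        finally show ?thesis by (rule sym)
      qed
      show ?thesis
      proof (rule amp_eqI)
        show "?G (phase_at y k (catalyzed v)) (2 * q) = catalyzed (scale_last (2 * i + 5) v) (2 * q)"
          "?G (phase_at y k (catalyzed v)) (Suc (2 * q)) = catalyzed (scale_last (2 * i + 5) v) (Suc (2 * q))" for q
          unfolding e unfolding catalyzed_coord coord_scale_last[OF d] lev2.simps using ex ey xy(3)
          by (simp_all add: x_def y_def catalyzed_coord double_not_eq_Suc_double Suc_double_not_eq_double)
      qed
    qed
    then show ?thesis unfolding r(3) y_def[symmetric]
      by (intro exI[of _ "2 * i + 5"] exI[of _ ?G] conjI G ballI)
  qed
qed

lemma prepare_catalyst: "loc 0 (\<lambda>_. m2_diag 1 (\<zeta> ^ 15)) (loc 0 (\<lambda>_. m2_H) (kron0 1 u)) = catalyzed u"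
  by (rule amp_eqI) (simp_all only: loc_0 kron0_coord catalyzed_coord cnj_zeta, simp_all)

lemma unprepare_catalyst: "loc 0 (\<lambda>_. m2_H) (loc 0 (\<lambda>_. m2_diag 1 \<zeta>) (catalyzed u)) = kron0 1 u"
proof -
  have z: "\<zeta> * (a * (cnj \<zeta> / rt2)) = a * (1 / rt2)" for a
    using cnj_zeta_mult(2) by (simp add: mult_ac flip: mult.assoc)
  have h: "1 / rt2 * (a * (1 / rt2)) + 1 / rt2 * (a * (1 / rt2)) = a"
    "1 / rt2 * (a * (1 / rt2)) + - 1 / rt2 * (a * (1 / rt2)) = 0" for a
    using rt2_squared by (simp_all add: field_simps)
  show ?thesis
    by (rule amp_eqI) (simp_all only: loc_0 kron0_coord catalyzed_coord z h mult_1_left mult_zero_left add_0_left add_0_right)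
qed

text \<open>With the ancilla reset to 0, a phase gate on it acts trivially except on what has been
  moved to the value 1. The two-level exchange moves exactly the last level there and back.\<close>

lemma unscale_last:
  assumes "m \<ge> 1"
  shows "\<exists>G. circuit_op_on (m + 1) G \<and> (\<forall>v\<in>carrier_vec (2 ^ m). G (kron0 1 (scale_last l v)) = kron0 1 v)"
proof -
  obtain r where r: "2 ^ m = Suc r" "2 ^ (m + 1) = 2 * Suc r" "mask (m + 1) = Suc (2 * r)"
    by (rule last_levels)
  define x y where "x = 2 * r" and "y = Suc (2 * r)"
  have xy: "x < 2 ^ (m + 1)" "y < 2 ^ (m + 1)" "x \<noteq> y"
    unfolding r(2) by (simp_all add: x_def y_def)
  have N: "m + 1 \<ge> 2" using assms by simp
  note iX = circuit_op_on_lev2_iX[OF N xy]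
  \<comment> \<open>\<open>15 l\<close> inverts \<open>\<zeta> ^ l\<close>, and the additional 8
    supplies the -1 that cancels the two factors \<i> of the exchanges.\<close>
  let ?z = "\<zeta> ^ (15 * l + 8)"
  let ?T = "loc 0 (\<lambda>_. m2_diag 1 ?z)"
  let ?G = "\<lambda>f. lev2 x y (0, \<i>, \<i>, 0) (?T (lev2 x y (0, \<i>, \<i>, 0) f))"
  have T: "circuit_op_on (m + 1) ?T" by (rule circuit_op_circuit_op_on[OF circuit_op_phase]) simp
  have G: "circuit_op_on (m + 1) ?G" by (rule circuit_op_on_comp[OF iX circuit_op_on_comp[OF T iX]])
  have z: "?z * \<zeta> ^ l = - 1"
  proof -
    have "?z * \<zeta> ^ l = (\<zeta> ^ 16) ^ l * \<zeta> ^ 8" by (simp flip: power_add power_mult add: add_ac)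
    then show ?thesis by (simp add: zeta_power16 zeta_power8)
  qed
  have iz: "\<i> * (?z * (\<i> * (\<zeta> ^ l * a))) = a" for a
  proof -
    have "\<i> * (?z * (\<i> * (\<zeta> ^ l * a))) = (\<i> * \<i>) * (?z * \<zeta> ^ l) * a"
      by (simp only: mult_ac)
    then show ?thesis unfolding z by simp
  qed
  have "?G (kron0 1 (scale_last l v)) = kron0 1 v" if v: "v \<in> carrier_vec (2 ^ m)" for v
  proof -
    have d: "dim_vec v = Suc r" using v r(1) by simp
    have 1: "lev2 x y (0, \<i>, \<i>, 0) (kron0 1 (scale_last l v)) = (kron0 1 v)(x := 0, y := \<i> * (\<zeta> ^ l * coord v r))"
      by (rule amp_eqI) (simp_all add: x_def y_def kron0_coord coord_scale_last[OF d] double_not_eq_Suc_double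
          Suc_double_not_eq_double del: One_nat_def)
    have 2: "?T ((kron0 1 v)(x := 0, y := \<i> * (\<zeta> ^ l * coord v r))) =
        (kron0 1 v)(x := 0, y := ?z * (\<i> * (\<zeta> ^ l * coord v r)))"
      by (rule amp_eqI) (simp_all add: x_def y_def kron0_coord loc_0 double_not_eq_Suc_double
          Suc_double_not_eq_double del: One_nat_def)
    show ?thesis unfolding 1 2
      by (rule amp_eqI) (simp_all add: x_def y_def kron0_coord iz double_not_eq_Suc_double
          Suc_double_not_eq_double del: One_nat_def)
  qed
  then show ?thesis by (intro exI[of _ ?G] conjI G ballI)
qed

lemma kron0_supp: "u \<in> carrier_vec (2 ^ m) \<Longrightarrow> supp (m + 1) (kron0 1 u)"
  by (auto simp: supp_def kron0_def)

lemma catalyzed_supp: "u \<in> carrier_vec (2 ^ m) \<Longrightarrow> supp (m + 1) (catalyzed u)"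
  by (auto simp: supp_def catalyzed_def)

lemma unitary_ring_represented:
  assumes m: "m \<ge> 1" and U: "U \<in> carrier_mat (2 ^ m) (2 ^ m)" "unitary U"
    and R: "\<And>i j. i < 2 ^ m \<Longrightarrow> j < 2 ^ m \<Longrightarrow> U $$ (i, j) \<in> ring_R 16"
  shows "exactly_represented 16 m 1 U"
proof -
  let ?N = "m + 1" and ?n = "2 ^ m :: nat"
  have "\<exists>F\<in>level_ops {..<2 * ?n}. \<forall>u\<in>carrier_vec ?n. F (catalyzed u) = catalyzed (U *\<^sub>v u)"
    by (rule catalyzed_level_ops[OF U]) (rule R)
  then obtain F where F: "F \<in> level_ops {..<2 ^ ?N}" "\<And>u. u \<in> carrier_vec ?n \<Longrightarrow> F (catalyzed u) = catalyzed (U *\<^sub>v u)"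
    by (elim bexE) simp
  have N: "?N \<ge> 2" using m by simp
  obtain k G where G: "circuit_op_on ?N G" "\<And>f. supp ?N f \<Longrightarrow> F f = phase_at (mask ?N) k (G f)"
    using level_ops_circuit[OF N F(1)] by (elim exE conjE) simp
  \<comment> \<open>\<open>F\<close> equals \<open>G\<close> followed by a phase on the last level,
    so \<open>G\<close> alone realizes \<open>U\<close> up to the inverse phase, with exponent
    \<open>7 k\<close>.\<close>
  have inv: "phase_at y (7 * k) (phase_at y k f) = f" for y f
  proof -
    have "\<omega> ^ (7 * k) * \<omega> ^ k = (\<omega> ^ 8) ^ k" by (simp flip: power_add power_mult)
    then have "\<omega> ^ (7 * k) * (\<omega> ^ k * a) = a" for a by (simp add: omega_power8 flip: mult.assoc)
    then show ?thesis by (simp add: phase_at_def fun_eq_iff)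
  qed
  have Gu: "G (catalyzed u) = phase_at (mask ?N) (7 * k) (catalyzed (U *\<^sub>v u))" if u: "u \<in> carrier_vec ?n" for u
    using G(2)[OF catalyzed_supp[OF u]] F(2)[OF u] inv by metis
  obtain l K where K: "circuit_op_on ?N K"
    "\<And>v. v \<in> carrier_vec ?n \<Longrightarrow> K (phase_at (mask ?N) (7 * k) (catalyzed v)) = catalyzed (scale_last l v)"
    using phase_to_scale_last[OF m, of "7 * k"] by (elim exE conjE) simp
  obtain E where E: "circuit_op_on ?N E" "\<And>v. v \<in> carrier_vec ?n \<Longrightarrow> E (kron0 1 (scale_last l v)) = kron0 1 v"
    using unscale_last[OF m, of l] by (elim exE conjE) simp
  have g: "circuit_op_on ?N (loc 0 (\<lambda>_. m2_H))" "circuit_op_on ?N (loc 0 (\<lambda>_. m2_diag 1 \<zeta>))"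
    "circuit_op_on ?N (loc 0 (\<lambda>_. m2_diag 1 (\<zeta> ^ 15)))"
    by (rule circuit_op_circuit_op_on[OF circuit_op_H], simp, rule circuit_op_circuit_op_on[OF circuit_op_T], simp, rule circuit_op_circuit_op_on[OF circuit_op_phase], simp)
  let ?A = "\<lambda>f. E (loc 0 (\<lambda>_. m2_H) (loc 0 (\<lambda>_. m2_diag 1 \<zeta>) (K (G
    (loc 0 (\<lambda>_. m2_diag 1 (\<zeta> ^ 15)) (loc 0 (\<lambda>_. m2_H) f))))))"
  have "circuit_op_on ?N ?A"
    by (rule circuit_op_on_comp[OF E(1) circuit_op_on_comp[OF g(1) circuit_op_on_comp[OF g(2) circuit_op_on_comp[OF K(1)
      circuit_op_on_comp[OF G(1) circuit_op_on_comp[OF g(3,1)]]]]]])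
  then obtain C where C: "circuit_ok ?N C" "\<And>f. supp ?N f \<Longrightarrow> capp ?N C f = ?A f"
    unfolding circuit_op_on_def by (elim exE conjE) simp
  have "capp ?N C (kron0 1 u) = kron0 1 (U *\<^sub>v u)" if u: "u \<in> carrier_vec ?n" for u
  proof -
    have v: "U *\<^sub>v u \<in> carrier_vec ?n" using U(1) u by simp
    show ?thesis
      unfolding C(2)[OF kron0_supp[OF u]] prepare_catalyst Gu[OF u] K(2)[OF v] unprepare_catalyst E(2)[OF v] ..
  qed
  then show ?thesis unfolding exactly_represented_iff[OF U(1)] using C(1) by blast
qed

theorem theorem6p3:
  fixes m :: nat and U :: "complex mat"
  assumes "m \<ge> 1" and "U \<in> carrier_mat (2 ^ m) (2 ^ m)"
  shows "((\<exists>a. exactly_represented 16 m a U) \<longleftrightarrow>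
            (unitary U \<and> (\<forall>i < 2 ^ m. \<forall>j < 2 ^ m. U $$ (i, j) \<in> ring_R 16)))
       \<and> ((unitary U \<and> (\<forall>i < 2 ^ m. \<forall>j < 2 ^ m. U $$ (i, j) \<in> ring_R 16))
            \<longrightarrow> exactly_represented 16 m 1 U)"
  using represented_imp_unitary_ring[OF assms(2)] unitary_ring_represented[OF assms] by blast

end
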